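(* Let $M$ be a matroid of rank $d+1$ on the ground set $E=\{0,1,\dots,n\}$, and let $0\le k\le d$. Then the $k$-dimensional Chern–Schwartz–MacPherson cycle $\mathrm{csm}_k(M)$ is a balanced weighted fan in $\mathbb{R}^{n+1}/\mathbf{1}$, i.e. it satisfies the balancing condition at every $(k-1)$-dimensional cone.
   Context: Notation: $\mathbf e_0,\dots,\mathbf e_n$ is the standard basis of $\mathbb{Z}^{n+1}$, $\mathbf e_S=\sum_{i\in S}\mathbf e_i$ for $S\subseteq E$, and $\mathbb{R}^{n+1}/\mathbf{1}=\mathbb{R}^{n+1}/\mathbb{R}\cdot\mathbf e_E$ with lattice $\mathbb{Z}^{n+1}/\mathbb{Z}\cdot \mathbf e_E$. For a loopless matroid $M$ on $E$ with lattice of flats $\mathcal L(M)$, the (projective) Bergman fan $\mathcal B(M)$ is the fan in $\mathbb{R}^{n+1}/\mathbf{1}$ whose cones are the images $\sigma_{\mathcal F}$ of $\mathrm{cone}(\mathbf e_{F_1},\dots,\mathbf e_{F_k})+\mathbb{R}\mathbf e_E$ for chains of flats $\mathcal F=\{\emptyset\subsetneq F_1\subsetneq\dots\subsetneq F_k\subsetneq E\}$; it is pure of dimension $d$ when $r(M)=d+1$. The Möbius function $\mu$ of $\mathcal L(M)$ is defined by $\mu(F,F)=1$, $\mu(F,G)=-\sum_{F\subseteq G'\subsetneq G}\mu(F,G')$ for $F\subsetneq G$, and $0$ otherwise. The beta invariant of a loopless matroid $N$ with rank function $r$ is $\beta(N)=(-1)^{r(N)}\sum_{F\in\mathcal L(N)}\mu(\emptyset,F)\,r(F)$;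 if $N$ has a loop, $\beta(N)=0$. For $0\le k\le d$, $\mathrm{csm}_k(M)$ is the $k$-dimensional skeleton of $\mathcal B(M)$ (cones $\sigma_{\mathcal F}$ for chains $\emptyset=F_0\subsetneq F_1\subsetneq\dots\subsetneq F_k\subsetneq F_{k+1}=E$ of flats) with weight $w(\sigma_{\mathcal F})=(-1)^{d-k}\prod_{i=0}^{k}\beta(M|F_{i+1}/F_i)$, where $M|F_{i+1}/F_i$ is the minor obtained by restricting to $F_{i+1}$ and contracting $F_i$; if $M$ has a loop, $\mathrm{csm}_k(M)=\emptyset$. Balancing: a pure $k$-dimensional rational weighted fan $\Sigma$ is balanced at a $(k-1)$-dimensional cone $\tau$ if, letting $L_\tau=\mathrm{span}_{\mathbb R}(\tau)$ and for each $k$-dimensional $\sigma\supsetneq\tau$ choosing a lattice vector $\mathbf v_\sigma$ with $\mathrm{span}_{\mathbb Z}(\mathbf v_\sigma, L_\tau\cap\text{lattice})=\mathrm{span}_{\mathbb R}(\sigma)\cap\text{lattice}$, one has $\sum_{\sigma\supsetneq\tau}w(\sigma)\mathbf v_\sigma\in L_\tau$; $\Sigma$ is balanced if this holds at every $(k-1)$-dimensional cone.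
   Formalization: In the balancing condition the lattice vector v_σ is also required to point into σ (v_σ ∈ σ + L_τ); the stated spanning condition fixes v_σ modulo L_τ only up to sign, and with arbitrary signs balancing fails, e.g. for U_{2,3} with k = 1. *)

theory Defs
  imports "HOL-Analysis.Analysis"
begin

section \<open>Matroids\<close>

record 'a set_system =
  ground :: "'a set"
  indep :: "'a set \<Rightarrow> bool"

locale matroid =
  fixes M :: "'a set_system"
  assumes finite_ground: "finite (ground M)"
    and indep_subset_ground: "indep M X \<Longrightarrow> X \<subseteq> ground M"
    and indep_empty: "indep M {}"
    and indep_subset: "indep M X \<Longrightarrow> Y \<subseteq> X \<Longrightarrow> indep M Y"
    and indep_augment:
      "indep M X \<Longrightarrow> indep M Y \<Longrightarrow> card X < card Y \<Longrightarrow> \<exists>y\<in>Y - X. indep M (insert y X)"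

definition rk :: "'a set_system \<Rightarrow> 'a set \<Rightarrow> nat" where
  "rk M X = Max (card ` {Y. Y \<subseteq> X \<and> indep M Y})"

definition matroid_rank :: "'a set_system \<Rightarrow> nat" where
  "matroid_rank M = rk M (ground M)"

definition loopless :: "'a set_system \<Rightarrow> bool" where
  "loopless M \<longleftrightarrow> (\<forall>e\<in>ground M. indep M {e})"

definition flats :: "'a set_system \<Rightarrow> 'a set set" where
  "flats M = {F. F \<subseteq> ground M \<and> (\<forall>e\<in>ground M - F. rk M F < rk M (insert e F))}"

definition basis_in :: "'a set_system \<Rightarrow> 'a set \<Rightarrow> 'a set \<Rightarrow> bool" where
  "basis_in M X B \<longleftrightarrow>
     B \<subseteq> X \<and> indep M B \<and> (\<forall>C. B \<subseteq> C \<and> C \<subseteq> X \<and> indep M C \<longrightarrow> C = B)"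

definition restriction :: "'a set_system \<Rightarrow> 'a set \<Rightarrow> 'a set_system" where
  "restriction M G = \<lparr>ground = G, indep = (\<lambda>X. X \<subseteq> G \<and> indep M X)\<rparr>"

definition contraction :: "'a set_system \<Rightarrow> 'a set \<Rightarrow> 'a set_system" where
  "contraction M F = \<lparr>ground = ground M - F,
     indep = (\<lambda>X. X \<subseteq> ground M - F \<and> (\<exists>B. basis_in M F B \<and> indep M (X \<union> B)))\<rparr>"

text \<open>\<open>minor M G F\<close> is the minor written $M|G/F$, for $F \subseteq G$.\<close>

definition minor :: "'a set_system \<Rightarrow> 'a set \<Rightarrow> 'a set \<Rightarrow> 'a set_system" where
  "minor M G F = contraction (restriction M G) F"

text \<open>The Moebius function of a family \<open>L\<close> of sets ordered by inclusion. The condition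
  \<^term>\<open>finite G\<close> is only there for termination.\<close>

function mobius :: "'a set set \<Rightarrow> 'a set \<Rightarrow> 'a set \<Rightarrow> int" where
  "mobius L F G =
     (if F = G then 1
      else if F \<subset> G \<and> finite G
        then - (\<Sum>G' \<in> {G' \<in> L. F \<subseteq> G' \<and> G' \<subset> G}. mobius L F G')
      else 0)"
  by pat_completeness auto
termination
  by (relation "Wellfounded.measure (\<lambda>(L, F, G). card G)") (auto intro: psubset_card_mono)

declare mobius.simps [simp del]

definition beta :: "'a set_system \<Rightarrow> int" where
  "beta N = (if loopless N
     then (- 1) ^ matroid_rank N * (\<Sum>F\<in>flats N. mobius (flats N) {} F * int (rk N F))
     else 0)"


section \<open>The space $\mathbb{R}^E/\mathbf{1}$ and its lattice\<close>

definition ind_vec :: "'e::finite set \<Rightarrow> real ^ 'e" where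
  "ind_vec S = (\<Sum>i\<in>S. axis i 1)"

quotient_type (overloaded) 'e torus =
  "real ^ ('e::finite)" / "\<lambda>x y. x - y \<in> span {ind_vec UNIV}"
  morphisms rep_torus torus_proj
proof (rule equivpI)
  let ?L = "span {ind_vec UNIV} :: (real ^ 'e) set"
  show "reflp (\<lambda>x y. x - y \<in> ?L)"
    by (simp add: reflp_def span_zero)
  show "symp (\<lambda>x y. x - y \<in> ?L)"
    by (rule sympI) (metis minus_diff_eq span_neg)
  show "transp (\<lambda>x y. x - y \<in> ?L)"
  proof (rule transpI)
    fix x y z :: "real ^ 'e"
    assume "x - y \<in> ?L" "y - z \<in> ?L"
    then have "(x - y) + (y - z) \<in> ?L" by (rule span_add)
    then show "x - z \<in> ?L" by simp
  qed
qed

instantiation torus :: (finite) real_vector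
begin

lift_definition zero_torus :: "'a torus" is 0 .

lift_definition plus_torus :: "'a torus \<Rightarrow> 'a torus \<Rightarrow> 'a torus" is "(+)"
  by (metis add_diff_add span_add)

lift_definition uminus_torus :: "'a torus \<Rightarrow> 'a torus" is uminus
  by (metis minus_diff_minus span_neg)

lift_definition minus_torus :: "'a torus \<Rightarrow> 'a torus \<Rightarrow> 'a torus" is "(-)"
proof -
  fix x x' y y' :: "real ^ 'a"
  assume "x - x' \<in> span {ind_vec UNIV}" "y - y' \<in> span {ind_vec UNIV}"
  then have "(x - x') - (y - y') \<in> span {ind_vec UNIV}" by (rule span_diff)
  then show "x - y - (x' - y') \<in> span {ind_vec UNIV}" by (simp add: algebra_simps)
qed

lift_definition scaleR_torus :: "real \<Rightarrow> 'a torus \<Rightarrow> 'a torus" is "scaleR"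
  by (metis scaleR_diff_right span_scale)

instance
  by standard (transfer; simp add: algebra_simps span_zero)+

end

text \<open>The image of $\mathbb{Z}^E$, which is $\mathbb{Z}^E/\mathbb{Z}\mathbf{1}$ because
  $\mathbb{Z}^E \cap \mathbb{R}\mathbf{1} = \mathbb{Z}\mathbf{1}$.\<close>

definition torus_lattice :: "'e::finite torus set" where
  "torus_lattice = torus_proj ` {x. \<forall>i. x $ i \<in> \<int>}"


section \<open>Weighted fans and balancing\<close>

text \<open>Throughout, \<open>\<Lambda>\<close> is the lattice with respect to which rationality is meant. Faces are
  required to be nonempty because the empty set is a face of every set for \<open>(face_of)\<close>.
  A weighted fan is a pair of a set of cones and a weight function, whose values matter
  only on the cones of top dimension.\<close>

definition rational_cone :: "'v::real_vector set \<Rightarrow> 'v set \<Rightarrow> bool" where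
  "rational_cone \<Lambda> \<sigma> \<longleftrightarrow> (\<exists>S. finite S \<and> S \<subseteq> \<Lambda> \<and> \<sigma> = convex_cone hull S)"

definition rational_fan :: "'v::real_vector set \<Rightarrow> 'v set set \<Rightarrow> bool" where
  "rational_fan \<Lambda> \<Sigma> \<longleftrightarrow>
     finite \<Sigma> \<and>
     (\<forall>\<sigma>\<in>\<Sigma>. rational_cone \<Lambda> \<sigma>) \<and>
     (\<forall>\<sigma>\<in>\<Sigma>. \<forall>\<tau>. \<tau> face_of \<sigma> \<and> \<tau> \<noteq> {} \<longrightarrow> \<tau> \<in> \<Sigma>) \<and>
     (\<forall>\<sigma>\<in>\<Sigma>. \<forall>\<tau>\<in>\<Sigma>. (\<sigma> \<inter> \<tau>) face_of \<sigma> \<and> (\<sigma> \<inter> \<tau>) face_of \<tau>)"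

definition pure_fan :: "nat \<Rightarrow> 'v::real_vector set set \<Rightarrow> bool" where
  "pure_fan k \<Sigma> \<longleftrightarrow> (\<forall>\<sigma>\<in>\<Sigma>. (\<forall>\<tau>\<in>\<Sigma>. \<sigma> \<subseteq> \<tau> \<longrightarrow> \<tau> = \<sigma>) \<longrightarrow> dim \<sigma> = k)"

definition skeleton :: "nat \<Rightarrow> 'v::real_vector set set \<Rightarrow> 'v set set" where
  "skeleton k \<Sigma> = {\<sigma> \<in> \<Sigma>. dim \<sigma> \<le> k}"

definition int_span :: "'v::real_vector set \<Rightarrow> 'v set" where
  "int_span = module.span (\<lambda>(m::int) x. of_int m *\<^sub>R x)"

text \<open>The admissible choices of $\mathbf{v}_\sigma$ at a facet \<open>\<tau>\<close> of \<open>\<sigma>\<close>. The generation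
  condition only determines the vector modulo $L_\tau$ up to sign; as usual, the sign is
  fixed by requiring that it points from \<open>\<tau>\<close> into \<open>\<sigma>\<close>.\<close>

definition lattice_normals :: "'v::real_vector set \<Rightarrow> 'v set \<Rightarrow> 'v set \<Rightarrow> 'v set" where
  "lattice_normals \<Lambda> \<tau> \<sigma> =
     {v \<in> \<Lambda>. (\<exists>l\<in>span \<tau>. v + l \<in> \<sigma>) \<and>
             int_span (insert v (span \<tau> \<inter> \<Lambda>)) = span \<sigma> \<inter> \<Lambda>}"

text \<open>The existence clause makes explicit that the universal quantification over choices is
  not vacuous.\<close>

definition balanced_at ::
  "'v::real_vector set \<Rightarrow> nat \<Rightarrow> 'v set set \<times> ('v set \<Rightarrow> int) \<Rightarrow> 'v set \<Rightarrow> bool" where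
  "balanced_at \<Lambda> k = (\<lambda>(\<Sigma>, w) \<tau>.
     let S = {\<sigma> \<in> \<Sigma>. dim \<sigma> = k \<and> \<tau> \<subset> \<sigma>} in
     (\<forall>\<sigma>\<in>S. lattice_normals \<Lambda> \<tau> \<sigma> \<noteq> {}) \<and>
     (\<forall>v. (\<forall>\<sigma>\<in>S. v \<sigma> \<in> lattice_normals \<Lambda> \<tau> \<sigma>) \<longrightarrow>
          (\<Sum>\<sigma>\<in>S. of_int (w \<sigma>) *\<^sub>R v \<sigma>) \<in> span \<tau>))"

definition balanced_fan ::
  "'v::real_vector set \<Rightarrow> nat \<Rightarrow> 'v set set \<times> ('v set \<Rightarrow> int) \<Rightarrow> bool" where
  "balanced_fan \<Lambda> k X \<longleftrightarrow>
     rational_fan \<Lambda> (fst X) \<and> pure_fan k (fst X) \<and>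
     (\<forall>\<tau>\<in>fst X. dim \<tau> + 1 = k \<longrightarrow> balanced_at \<Lambda> k X \<tau>)"


section \<open>Bergman fans and CSM cycles\<close>

text \<open>A chain $\emptyset \subsetneq F_1 \subsetneq \dots \subsetneq F_k \subsetneq E$ of flats
  is represented by the list $[F_1, \dots, F_k]$; \<open>chain_ext\<close> adds the two ends.\<close>

definition chain_ext :: "'a set_system \<Rightarrow> 'a set list \<Rightarrow> 'a set list" where
  "chain_ext M Fs = [{}] @ Fs @ [ground M]"

definition flat_chain :: "'a set_system \<Rightarrow> 'a set list \<Rightarrow> bool" where
  "flat_chain M Fs \<longleftrightarrow> set Fs \<subseteq> flats M \<and> sorted_wrt (\<subset>) (chain_ext M Fs)"

definition chain_cone :: "'e::finite set list \<Rightarrow> 'e torus set" where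
  "chain_cone Fs = torus_proj `
     {x + y | x y. x \<in> convex_cone hull (ind_vec ` set Fs) \<and> y \<in> span {ind_vec UNIV}}"

definition bergman_fan :: "'e::finite set_system \<Rightarrow> 'e torus set set" where
  "bergman_fan M = {chain_cone Fs | Fs. flat_chain M Fs}"

text \<open>With \<open>d = matroid_rank M - 1\<close>; the product runs over the steps $F_i \subsetneq F_{i+1}$,
  $0 \le i \le k$, of the chain including its two ends.\<close>

definition chain_weight :: "'a set_system \<Rightarrow> nat \<Rightarrow> 'a set list \<Rightarrow> int" where
  "chain_weight M k Fs = (- 1) ^ (matroid_rank M - 1 - k) *
     (\<Prod>i = 0..k. beta (minor M (chain_ext M Fs ! (i + 1)) (chain_ext M Fs ! i)))"

text \<open>A cone of the Bergman fan determines its chain of flats, so the definite description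
  is meaningful.\<close>

definition csm ::
  "nat \<Rightarrow> 'e::finite set_system \<Rightarrow> 'e torus set set \<times> ('e torus set \<Rightarrow> int)" where
  "csm k M =
     (if loopless M then skeleton k (bergman_fan M) else {},
      \<lambda>\<sigma>. chain_weight M k (THE Fs. flat_chain M Fs \<and> chain_cone Fs = \<sigma>))"

end

(* With b(A,B) the beta invariant of M|B/A up to sign, b = mu R zeta - R in the incidence algebra
   of the lattice of flats, where R is the diagonal matrix of ranks. Balancing at a chain reduces to
   one gap A < B of it, where it says that the sum of b(A,F) b(F,B) over the flats F in [A,B] that
   contain e does not depend on e in B - A. By Moebius inversion this sum is, up to a term without e,
   the sum of mu(A,H) r(H) r(H v e) over H, with ranks taken relative to A. As r(H v e) - r(H) is 0
   or 1, the product r(H) r(H v e) is half of r(H)^2 + r(H) plus a function of H v e, and the latter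
   contributes nothing by Weisner's theorem.
   On the polyhedral side, the cone over a chain is cut out by inequalities between coordinates, and
   differences of two coordinates are integral functionals dual to the generators of the cone; this
   gives the fan axioms, the dimensions and the lattice normals. *)

theory Submission
  imports Defs
begin


section \<open>Rank, closure and minors of a matroid\<close>

text \<open>A cone covering the cone of a chain adds one flat F in one gap A < B, and its weight is
  a factor common to the whole gap times the beta invariants of the two steps A < F and F < B. Each
  gap balances by itself: in the sum of b(A,F) b(F,B) e_F the coordinates in A all agree and those
  outside B vanish, so once the coordinates in B - A agree as well, the sum is a combination of e_A
  and e_B. Both lie in the span of the smaller cone, because the two ends of the chain, the empty
  set and E, give the zero vector of the quotient.

  Two identities of the incidence algebra are needed, mu zeta = 1 and zeta mu = 1. The recursion for
  mu yields only the first, although the join with e comes from the second.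

  Balancing is required for every admissible choice of lattice normals. It is therefore not enough
  that e_F is one of them: any other choice must differ from e_F by an element of the span of the
  smaller cone.\<close>

context matroid
begin

lemma finite_subset_ground: "X \<subseteq> ground M \<Longrightarrow> finite X"
  using finite_ground finite_subset by blast

lemma finite_indep: "indep M X \<Longrightarrow> finite X"
  using finite_subset_ground indep_subset_ground by blast

lemma finite_indep_subsets: "finite {Y. Y \<subseteq> X \<and> indep M Y}"
  by (rule finite_subset[of _ "Pow (ground M)"])
     (use indep_subset_ground finite_ground in auto)

lemma card_le_rk: "Y \<subseteq> X \<Longrightarrow> indep M Y \<Longrightarrow> card Y \<le> rk M X"
  unfolding rk_def by (rule Max_ge) (use finite_indep_subsets[of X] in auto)

lemma rk_witness: obtains B where "B \<subseteq> X" "indep M B" "card B = rk M X"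
proof -
  have "rk M X \<in> card ` {Y. Y \<subseteq> X \<and> indep M Y}"
    unfolding rk_def by (rule Max_in) (use finite_indep_subsets[of X] indep_empty in auto)
  then show thesis using that by auto
qed

lemma rk_mono: "X \<subseteq> Y \<Longrightarrow> rk M X \<le> rk M Y"
proof -
  assume "X \<subseteq> Y"
  obtain B where "B \<subseteq> X" "indep M B" "card B = rk M X" by (rule rk_witness)
  with \<open>X \<subseteq> Y\<close> show ?thesis using card_le_rk[of B Y] by auto
qed

lemma rk_empty [simp]: "rk M {} = 0"
  by (rule rk_witness[where X = "{}"]) auto

lemma indep_extend:
  assumes "B \<subseteq> X" "indep M B"
  obtains C where "B \<subseteq> C" "C \<subseteq> X" "indep M C" "card C = rk M X"
proof -
  have "\<exists>C. B \<subseteq> C \<and> C \<subseteq> X \<and> indep M C \<and> card C = rk M X"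
    using assms
  proof (induction "rk M X - card B" arbitrary: B rule: less_induct)
    case less
    show ?case
    proof (cases "card B = rk M X")
      case True
      then show ?thesis using less.prems by blast
    next
      case False
      then have lt: "card B < rk M X"
        using card_le_rk less.prems by (simp add: order_less_le)
      obtain D where D: "D \<subseteq> X" "indep M D" "card D = rk M X" by (rule rk_witness)
      then obtain y where y: "y \<in> D - B" "indep M (insert y B)"
        using indep_augment[of B D] less.prems lt by auto
      have "card (insert y B) = Suc (card B)"
        using y less.prems finite_indep by simp
      moreover have "insert y B \<subseteq> X" using y(1) D(1) less.prems(1) by blast
      ultimately obtain C where "insert y B \<subseteq> C" "C \<subseteq> X" "indep M C" "card C = rk M X"
        using less.hyps[of "insert y B"] lt y(2) by (auto simp: diff_less_mono2)
      then show ?thesis by blast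
    qed
  qed
  then show thesis using that by blast
qed

text \<open>Contraction is defined through inclusion-maximal independent sets; by augmentation these
  are the ones of maximal cardinality, so rank counts apply to them.\<close>

lemma basis_in_iff: "basis_in M X B \<longleftrightarrow> B \<subseteq> X \<and> indep M B \<and> card B = rk M X"
proof
  assume B: "basis_in M X B"
  then obtain C where "B \<subseteq> C" "C \<subseteq> X" "indep M C" "card C = rk M X"
    using indep_extend[of B X] unfolding basis_in_def by blast
  then show "B \<subseteq> X \<and> indep M B \<and> card B = rk M X"
    using B unfolding basis_in_def by blast
next
  assume B: "B \<subseteq> X \<and> indep M B \<and> card B = rk M X"
  have "C = B" if "B \<subseteq> C" "C \<subseteq> X" "indep M C" for C
    using card_subset_eq[OF finite_indep[OF that(3)] that(1)] card_le_rk[OF that(2,3)]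
      card_mono[OF finite_indep[OF that(3)] that(1)] B by simp
  then show "basis_in M X B" unfolding basis_in_def using B by blast
qed

lemma rk_insert_le: "rk M (insert e X) \<le> Suc (rk M X)"
proof -
  obtain B where B: "B \<subseteq> insert e X" "indep M B" "card B = rk M (insert e X)"
    by (rule rk_witness)
  have "card (B - {e}) \<le> rk M X"
    using B indep_subset[of B "B - {e}"] by (intro card_le_rk) auto
  then show ?thesis
    using B(3) by (cases "e \<in> B") (auto simp: card_Diff_singleton_if)
qed

text \<open>A local form of submodularity. Bases are nested along \<open>X\<close>, \<open>Y\<close>
  and \<open>insert e Y\<close>; if the last rank rises, the largest basis contains
  \<open>e\<close>, and then \<open>e\<close> can already be added to the basis of
  \<open>X\<close>.\<close>

lemma rk_insert_stable:
  assumes "X \<subseteq> Y" "rk M (insert e X) = rk M X"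
  shows "rk M (insert e Y) = rk M Y"
proof (rule ccontr)
  assume "rk M (insert e Y) \<noteq> rk M Y"
  then have lt: "rk M Y < rk M (insert e Y)"
    using rk_mono[OF subset_insertI, of Y e] by linarith
  obtain B where B: "B \<subseteq> X" "indep M B" "card B = rk M X" by (rule rk_witness)
  obtain C where C: "B \<subseteq> C" "C \<subseteq> Y" "indep M C" "card C = rk M Y"
    using indep_extend[of B Y] B assms(1) by blast
  obtain D where D: "C \<subseteq> D" "D \<subseteq> insert e Y" "indep M D" "card D = rk M (insert e Y)"
    using indep_extend[of C "insert e Y"] C by blast
  have "\<not> D \<subseteq> Y" using card_le_rk[of D Y] D lt by auto
  then have "e \<in> D" using D(2) by blast
  moreover have "e \<notin> Y" using lt by (auto simp: insert_absorb)
  then have "e \<notin> C" using C(2) by blast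
  ultimately have "insert e B \<subseteq> D" "e \<notin> B" using B C D by auto
  then have "Suc (card B) \<le> rk M (insert e X)"
    using card_le_rk[of "insert e B" "insert e X"] indep_subset[OF D(3)] B finite_indep
    by fastforce
  then show False using B assms by simp
qed

text \<open>If the rank rose, augmenting a basis of \<open>X\<close> from a larger independent set
  would produce a single element that already raises the rank of \<open>X\<close>.\<close>

lemma rk_Un_stable:
  assumes "\<And>e. e \<in> A \<Longrightarrow> rk M (insert e X) = rk M X"
  shows "rk M (X \<union> A) = rk M X"
proof (rule ccontr)
  assume "rk M (X \<union> A) \<noteq> rk M X"
  then have lt: "rk M X < rk M (X \<union> A)"
    using rk_mono[OF Un_upper1, of X A] by linarith
  obtain B where B: "B \<subseteq> X" "indep M B" "card B = rk M X" by (rule rk_witness)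
  obtain D where D: "D \<subseteq> X \<union> A" "indep M D" "card D = rk M (X \<union> A)" by (rule rk_witness)
  obtain y where y: "y \<in> D - B" "indep M (insert y B)"
    using indep_augment[of B D] B D lt by auto
  have "Suc (card B) \<le> rk M (insert y X)"
    using card_le_rk[of "insert y B" "insert y X"] y B finite_indep by fastforce
  moreover have "rk M (insert y X) = rk M X"
    using y D assms by (cases "y \<in> X") (auto simp: insert_absorb)
  ultimately show False using B by simp
qed

text \<open>The least flat containing \<open>X\<close>. Applied to \<open>insert e H\<close> it
  gives the join of a flat \<open>H\<close> with an element \<open>e\<close>.\<close>

definition matroid_closure :: "'a set \<Rightarrow> 'a set" where
  "matroid_closure X = {e \<in> ground M. rk M (insert e X) = rk M X}"

lemma subset_closure: "X \<subseteq> ground M \<Longrightarrow> X \<subseteq> matroid_closure X"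
  unfolding matroid_closure_def by (auto simp: insert_absorb)

lemma rk_closure:
  assumes "X \<subseteq> ground M"
  shows "rk M (matroid_closure X) = rk M X"
proof -
  have "rk M (X \<union> matroid_closure X) = rk M X"
    by (rule rk_Un_stable) (auto simp: matroid_closure_def)
  then show ?thesis using subset_closure[OF assms] by (simp add: Un_absorb1)
qed

lemma closure_flat:
  assumes "X \<subseteq> ground M"
  shows "matroid_closure X \<in> flats M"
proof -
  have "rk M (matroid_closure X) < rk M (insert e (matroid_closure X))"
    if e: "e \<in> ground M - matroid_closure X" for e
  proof -
    have "rk M X < rk M (insert e X)"
      using e rk_mono[OF subset_insertI, of X e] unfolding matroid_closure_def by force
    also have "\<dots> \<le> rk M (insert e (matroid_closure X))"
      using subset_closure[OF assms] by (intro rk_mono) auto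
    finally show ?thesis using rk_closure[OF assms] by simp
  qed
  then show ?thesis unfolding flats_def matroid_closure_def by auto
qed

lemma flat_subset_ground: "F \<in> flats M \<Longrightarrow> F \<subseteq> ground M"
  unfolding flats_def by simp

lemma rk_insert_less: "F \<in> flats M \<Longrightarrow> e \<in> ground M \<Longrightarrow> e \<notin> F \<Longrightarrow> rk M F < rk M (insert e F)"
  unfolding flats_def by simp

lemma finite_flats: "finite (flats M)"
  by (rule finite_subset[of _ "Pow (ground M)"]) (use finite_ground flat_subset_ground in auto)

lemma finite_flat: "F \<in> flats M \<Longrightarrow> finite F"
  using finite_subset_ground flat_subset_ground by blast

lemma closure_subset_flat:
  assumes "X \<subseteq> F" "F \<in> flats M"
  shows "matroid_closure X \<subseteq> F"
proof
  fix e assume "e \<in> matroid_closure X"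
  then have "e \<in> ground M" "rk M (insert e F) = rk M F"
    using rk_insert_stable[OF assms(1)] unfolding matroid_closure_def by auto
  then show "e \<in> F" using rk_insert_less[OF assms(2)] by force
qed

lemma closure_subset_flat_iff:
  assumes "X \<subseteq> ground M" "F \<in> flats M"
  shows "matroid_closure X \<subseteq> F \<longleftrightarrow> X \<subseteq> F"
  using assms closure_subset_flat subset_closure by blast

lemma rk_insert_flat:
  assumes "F \<in> flats M" "e \<in> ground M"
  shows "rk M (insert e F) = rk M F + (if e \<in> F then 0 else 1)"
proof (cases "e \<in> F")
  case False
  then have "rk M F < rk M (insert e F)" using assms unfolding flats_def by blast
  then show ?thesis using rk_insert_le[of e F] False by simp
qed (simp add: insert_absorb)

lemma ground_flat: "ground M \<in> flats M"
  unfolding flats_def by simp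

lemma rk_singleton: "indep M {e} \<Longrightarrow> rk M {e} = 1"
  using card_le_rk[of "{e}" "{e}"] rk_insert_le[of e "{}"] by simp

lemma empty_flat: "loopless M \<Longrightarrow> {} \<in> flats M"
  unfolding flats_def loopless_def using rk_singleton by simp

text \<open>The closure of \<open>A\<close> with one element of \<open>B - A\<close> has rank one
  more than \<open>A\<close>, hence less than \<open>B\<close>. This is what makes short chains
  refinable and the fan pure.\<close>

lemma flat_between:
  assumes "A \<in> flats M" "B \<in> flats M" "A \<subseteq> B" "rk M A + 2 \<le> rk M B"
  obtains F where "F \<in> flats M" "A \<subset> F" "F \<subset> B"
proof -
  have "A \<noteq> B" using assms(4) by auto
  then obtain e where e: "e \<in> B - A" using assms(3) by blast
  then have eg: "e \<in> ground M" using assms(2) flat_subset_ground by blast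
  then have sub: "insert e A \<subseteq> ground M" using assms(1) flat_subset_ground by blast
  let ?F = "matroid_closure (insert e A)"
  have r: "rk M ?F = rk M A + 1" using rk_closure[OF sub] rk_insert_flat[OF assms(1) eg] e by simp
  have 1: "insert e A \<subseteq> ?F" using subset_closure[OF sub] .
  have 2: "?F \<subseteq> B" using closure_subset_flat[of "insert e A" B] assms e by auto
  have "?F \<noteq> B" using r assms(4) by auto
  then show thesis using that[of ?F] closure_flat[OF sub] 1 2 e by blast
qed

section \<open>Rank function and flats of a minor\<close>

lemma ground_minor: "ground (minor M G F) = G - F"
  unfolding minor_def restriction_def contraction_def by simp

lemma basis_in_restriction: "F \<subseteq> G \<Longrightarrow> basis_in (restriction M G) F B \<longleftrightarrow> basis_in M F B"
  unfolding basis_in_def restriction_def set_system.simps by (meson order_trans)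

lemma indep_minor:
  assumes "F \<subseteq> G"
  shows "indep (minor M G F) X \<longleftrightarrow> X \<subseteq> G - F \<and> (\<exists>B. basis_in M F B \<and> indep M (X \<union> B))"
proof -
  have eq: "basis_in (restriction M G) F = basis_in M F"
    by (rule ext) (rule basis_in_restriction[OF assms])
  have sub: "X \<union> B \<subseteq> G" if "X \<subseteq> G - F" "basis_in M F B" for B
    using that assms unfolding basis_in_iff by blast
  have "ground (restriction M G) = G"
    "indep (restriction M G) Y \<longleftrightarrow> Y \<subseteq> G \<and> indep M Y" for Y
    by (simp_all add: restriction_def)
  then have "indep (minor M G F) X \<longleftrightarrow>
      X \<subseteq> G - F \<and> (\<exists>B. basis_in M F B \<and> X \<union> B \<subseteq> G \<and> indep M (X \<union> B))"
    by (simp only: minor_def contraction_def eq set_system.simps)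
  with sub show ?thesis by meson
qed

text \<open>Extend a basis \<open>B\<close> of \<open>F\<close> to a basis \<open>C\<close> of
  \<open>X \<union> F\<close>; then \<open>C - B\<close> is optimal. Contraction allows any basis of
  \<open>F\<close> as a witness, which is harmless because all of them have \<open>rk M F\<close>
  elements. The additive form avoids subtraction of naturals.\<close>

lemma rk_minor:
  assumes "F \<subseteq> G" "G \<subseteq> ground M" "X \<subseteq> G - F"
  shows "rk (minor M G F) X + rk M F = rk M (X \<union> F)"
proof -
  let ?I = "{Y. Y \<subseteq> X \<and> indep (minor M G F) Y}"
  obtain B where B: "B \<subseteq> F" "indep M B" "card B = rk M F" by (rule rk_witness)
  obtain C where C: "B \<subseteq> C" "C \<subseteq> X \<union> F" "indep M C" "card C = rk M (X \<union> F)"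
    using indep_extend[of B "X \<union> F"] B by blast
  have bas: "basis_in M F B" using B by (simp add: basis_in_iff)
  have "indep M (C \<inter> F)" using indep_subset[OF C(3)] by simp
  moreover have "B \<subseteq> C \<inter> F" using B(1) C(1) by simp
  ultimately have "C \<inter> F = B"
    using bas by (simp add: basis_in_def)
  then have "C - B \<subseteq> X" "C - B \<subseteq> G - F" using C(2) assms(3) by auto
  moreover have "(C - B) \<union> B = C" using C(1) by blast
  ultimately have Y: "C - B \<in> ?I"
    using C(3) bas indep_minor[OF assms(1), of "C - B"] by auto
  have fin: "finite ?I"
    by (rule finite_subset[of _ "Pow (ground M)"]) (use assms finite_ground in auto)
  have le: "card Y + rk M F \<le> rk M (X \<union> F)" if YI: "Y \<in> ?I" for Y
  proof -
    obtain D where D: "basis_in M F D" "indep M (Y \<union> D)" "Y \<subseteq> G - F"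
      using YI indep_minor[OF assms(1), of Y] by auto
    have DF: "D \<subseteq> F" "card D = rk M F" using D(1) unfolding basis_in_iff by simp_all
    then have "Y \<inter> D = {}" using D(3) by blast
    then have "card (Y \<union> D) = card Y + card D"
      using finite_indep[OF D(2)] by (simp add: card_Un_disjoint)
    moreover have "card (Y \<union> D) \<le> rk M (X \<union> F)"
      using card_le_rk[OF _ D(2), of "X \<union> F"] YI DF by auto
    moreover note DF(2)
    ultimately show ?thesis by simp
  qed
  have cY: "card (C - B) + rk M F = rk M (X \<union> F)"
    using C B card_Diff_subset[of B C] card_mono[of C B] finite_indep[OF C(3)] finite_indep[OF B(2)]
    by simp
  have "rk (minor M G F) X = card (C - B)"
    unfolding rk_def
  proof (rule Max_eqI)
    show "finite (card ` ?I)" using fin by simp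
    show "card (C - B) \<in> card ` ?I" using Y by blast
    show "y \<le> card (C - B)" if "y \<in> card ` ?I" for y
    proof -
      from that obtain Y where "Y \<in> ?I" "y = card Y" by blast
      then show ?thesis using le[of Y] cY by linarith
    qed
  qed
  then show ?thesis using cY by simp
qed

text \<open>Every element outside a flat raises its rank, so contracting a flat creates no loops.
  Hence \<open>beta\<close> of such a minor is always given by the Moebius sum and not by the
  default 0.\<close>

lemma loopless_minor:
  assumes "A \<in> flats M" "A \<subseteq> B" "B \<subseteq> ground M"
  shows "loopless (minor M B A)"
  unfolding loopless_def ground_minor
proof
  fix e assume e: "e \<in> B - A"
  obtain D where D: "D \<subseteq> A" "indep M D" "card D = rk M A" by (rule rk_witness)
  obtain C where C: "D \<subseteq> C" "C \<subseteq> insert e A" "indep M C" "card C = rk M (insert e A)"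
    using indep_extend[of D "insert e A"] D by blast
  have "rk M (insert e A) = rk M A + 1"
    using rk_insert_flat[OF assms(1), of e] e assms(3) by auto
  then have "e \<in> C"
    using C card_le_rk[of C A] by (metis Suc_eq_plus1 not_less_eq_eq order_refl subset_insert)
  then have "indep M ({e} \<union> D)" using C indep_subset by auto
  then show "indep (minor M B A) {e}"
    using indep_minor[OF assms(2)] e D basis_in_iff by blast
qed

lemma flats_minor:
  assumes "A \<in> flats M" "B \<in> flats M" "A \<subseteq> B"
  shows "flats (minor M B A) = (\<lambda>F. F - A) ` {F \<in> flats M. A \<subseteq> F \<and> F \<subseteq> B}"
proof -
  have Bg: "B \<subseteq> ground M" using assms flat_subset_ground by blast
  have rkm: "rk (minor M B A) X + rk M A = rk M (X \<union> A)" if "X \<subseteq> B - A" for X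
    using rk_minor assms Bg that by blast
  have main: "H \<in> flats (minor M B A) \<longleftrightarrow> H \<union> A \<in> flats M" if H: "H \<subseteq> B - A" for H
  proof -
    \<comment> \<open>Flats of \<open>M\<close> are also tested on elements outside
      \<open>B\<close>, which the minor does not see. Such an element raises the rank of the flat
      \<open>B\<close>, hence of every subset of \<open>B\<close>.\<close>
    have out: "rk M (H \<union> A) < rk M (insert e (H \<union> A))" if "e \<in> ground M - B" for e
    proof -
      have "rk M (insert e B) \<noteq> rk M B" using rk_insert_less[OF assms(2)] that by force
      then have "rk M (insert e (H \<union> A)) \<noteq> rk M (H \<union> A)"
        using rk_insert_stable[of "H \<union> A" B e] H assms by blast
      then show ?thesis using rk_mono[OF subset_insertI, of "H \<union> A" e] by linarith
    qed
    have "rk (minor M B A) H < rk (minor M B A) (insert e H) \<longleftrightarrow>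
        rk M (H \<union> A) < rk M (insert e (H \<union> A))" if "e \<in> B - A - H" for e
      using rkm[OF H] rkm[of "insert e H"] that H
      by (metis DiffD1 Un_insert_left add_less_cancel_right insert_subset)
    moreover have "e \<in> B - A - H \<or> e \<in> ground M - B" if "e \<in> ground M - (H \<union> A)" for e
      using that by blast
    moreover have "e \<in> ground M - (H \<union> A)" if "e \<in> B - A - H" for e
      using that Bg by blast
    ultimately have "(\<forall>e\<in>B - A - H. rk (minor M B A) H < rk (minor M B A) (insert e H)) \<longleftrightarrow>
        (\<forall>e\<in>ground M - (H \<union> A). rk M (H \<union> A) < rk M (insert e (H \<union> A)))"
      using out by meson
    then show ?thesis
      unfolding flats_def ground_minor using H Bg assms(3) by auto
  qed
  show ?thesis
  proof (intro equalityI subsetI)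
    fix H assume "H \<in> flats (minor M B A)"
    moreover from this have "H \<subseteq> B - A" by (simp add: flats_def ground_minor)
    ultimately show "H \<in> (\<lambda>F. F - A) ` {F \<in> flats M. A \<subseteq> F \<and> F \<subseteq> B}"
      using main assms by (intro image_eqI[of _ _ "H \<union> A"]) auto
  next
    fix H assume "H \<in> (\<lambda>F. F - A) ` {F \<in> flats M. A \<subseteq> F \<and> F \<subseteq> B}"
    then obtain F where F: "F \<in> flats M" "A \<subseteq> F" "F \<subseteq> B" "H = F - A" by blast
    then have "H \<union> A = F" by blast
    then show "H \<in> flats (minor M B A)" using main[of H] F by auto
  qed
qed

end


section \<open>Moebius functions\<close>

definition interval_in :: "'a set set \<Rightarrow> 'a set \<Rightarrow> 'a set \<Rightarrow> 'a set set" where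
  "interval_in L A B = {F \<in> L. A \<subseteq> F \<and> F \<subseteq> B}"

lemma finite_interval_in: "finite L \<Longrightarrow> finite (interval_in L A B)"
  unfolding interval_in_def by simp

lemma interval_in_above: "A \<subseteq> H \<Longrightarrow> interval_in L H B = {F \<in> interval_in L A B. H \<subseteq> F}"
  unfolding interval_in_def by auto

lemma interval_in_below: "F \<subseteq> B \<Longrightarrow> interval_in L A F = {H \<in> interval_in L A B. H \<subseteq> F}"
  unfolding interval_in_def by auto

lemma mobius_self [simp]: "mobius L A A = 1"
  by (subst mobius.simps) simp

lemma sum_mobius_lower:
  assumes "finite L" "A \<in> L" "B \<in> L" "A \<subseteq> B" "finite B"
  shows "(\<Sum>F\<in>interval_in L A B. mobius L A F) = (if A = B then 1 else 0)"
proof (cases "A = B")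
  case True
  then have "interval_in L A B = {A}" using assms(2) unfolding interval_in_def by auto
  then show ?thesis using True by simp
next
  case False
  let ?J = "{F \<in> L. A \<subseteq> F \<and> F \<subset> B}"
  have eq: "interval_in L A B = insert B ?J" using assms unfolding interval_in_def by auto
  have "(\<Sum>F\<in>interval_in L A B. mobius L A F) = mobius L A B + (\<Sum>F\<in>?J. mobius L A F)"
    unfolding eq using assms(1) by (subst sum.insert) auto
  moreover have "mobius L A B = - (\<Sum>F\<in>?J. mobius L A F)"
    using False assms by (subst mobius.simps) auto
  ultimately show ?thesis using False by simp
qed

text \<open>In the incidence algebra this is zeta mu = 1, whereas the recursion expresses mu zeta =
  1. As for matrices, a one-sided inverse is two-sided.\<close>

lemma sum_mobius_upper:
  assumes L: "finite L" "\<And>F. F \<in> L \<Longrightarrow> finite F"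
    and "A \<in> L" "B \<in> L" "A \<subseteq> B"
  shows "(\<Sum>F\<in>interval_in L A B. mobius L F B) = (if A = B then 1 else 0)"
  using assms(3,5)
proof (induction "card B - card A" arbitrary: A rule: less_induct)
  case less
  let ?I = "interval_in L A B"
  \<comment> \<open>The error of the claim with left end \<open>H\<close>. Summed against
    \<open>mobius L A H\<close> it gives mu (zeta mu - 1) = (mu zeta) mu - mu = 0 after exchanging
    the sums, while by induction only the term \<open>H = A\<close> survives.\<close>
  let ?X = "\<lambda>H. (\<Sum>F\<in>interval_in L H B. mobius L F B) - (if H = B then 1 else 0)"
  have fB: "finite B" using L assms(4) by blast
  have fI: "finite ?I" using finite_interval_in[OF L(1)] .
  have AI: "A \<in> ?I" and BI: "B \<in> ?I" using less.prems assms(4) unfolding interval_in_def by auto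
  have zero: "?X H = 0" if "H \<in> ?I - {A}" for H
  proof -
    have H: "H \<in> L" "A \<subset> H" "H \<subseteq> B" using that unfolding interval_in_def by auto
    then have "card A < card H" "card H \<le> card B"
      using fB by (auto intro: psubset_card_mono card_mono finite_subset)
    then have "card B - card H < card B - card A" by simp
    then show ?thesis using less.hyps[of H] H by simp
  qed
  have "(\<Sum>H\<in>?I. mobius L A H * ?X H) =
      (\<Sum>H\<in>?I. \<Sum>F\<in>{F \<in> ?I. H \<subseteq> F}. mobius L A H * mobius L F B) - mobius L A B"
  proof -
    have "(\<Sum>H\<in>?I. mobius L A H * (if H = B then 1 else 0)) = mobius L A B"
      using BI fI by (simp add: if_distrib cong: if_cong)
    moreover have "interval_in L H B = {F \<in> ?I. H \<subseteq> F}" if "H \<in> ?I" for H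
      using that interval_in_above[of A H] unfolding interval_in_def by auto
    ultimately show ?thesis
      by (simp add: right_diff_distrib sum_subtractf sum_distrib_left)
  qed
  also have "(\<Sum>H\<in>?I. \<Sum>F\<in>{F \<in> ?I. H \<subseteq> F}. mobius L A H * mobius L F B) =
      (\<Sum>F\<in>?I. \<Sum>H\<in>{H \<in> ?I. H \<subseteq> F}. mobius L A H * mobius L F B)"
    by (rule sum.swap_restrict[OF fI fI])
  also have "\<dots> = (\<Sum>F\<in>?I. (if A = F then 1 else 0) * mobius L F B)"
  proof (rule sum.cong[OF refl])
    fix F assume "F \<in> ?I"
    then have F: "F \<in> L" "A \<subseteq> F" "F \<subseteq> B" unfolding interval_in_def by auto
    show "(\<Sum>H\<in>{H \<in> ?I. H \<subseteq> F}. mobius L A H * mobius L F B) = (if A = F then 1 else 0) * mobius L F B"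
      using sum_mobius_lower[OF L(1) less.prems(1) F(1,2) L(2)[OF F(1)]]
      by (simp add: sum_distrib_right[symmetric] interval_in_below[OF F(3), symmetric])
  qed
  also have "\<dots> = mobius L A B"
    using AI fI by (simp add: if_distrib[of "\<lambda>x. x * _"] cong: if_cong)
  finally have "(\<Sum>H\<in>?I. mobius L A H * ?X H) = 0" by simp
  moreover have "(\<Sum>H\<in>?I. mobius L A H * ?X H) = mobius L A A * ?X A"
    using zero by (subst sum.remove[OF fI AI]) simp
  ultimately show ?case by simp
qed

section \<open>Beta invariants of minors\<close>

context matroid
begin

definition rk_between :: "'a set \<Rightarrow> 'a set \<Rightarrow> int" where
  "rk_between A F = int (rk M F) - int (rk M A)"

text \<open>The function b of the overview. It refers only to the lattice of flats of
  \<open>M\<close>, so that all minors share one incidence algebra.\<close>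

definition signed_beta :: "'a set \<Rightarrow> 'a set \<Rightarrow> int" where
  "signed_beta A B = (\<Sum>H\<in>interval_in (flats M) A B. mobius (flats M) A H * rk_between A H)"

lemma signed_beta_self [simp]: "signed_beta A A = 0"
proof -
  have "interval_in (flats M) A A \<subseteq> {A}" unfolding interval_in_def by auto
  then show ?thesis unfolding signed_beta_def rk_between_def
    by (intro sum.neutral) auto
qed

text \<open>Removing \<open>A\<close> maps the interval from \<open>A\<close> to \<open>B\<close>
  isomorphically onto the lattice of flats of the minor, and the recursion only sees the
  order.\<close>

lemma mobius_minor:
  assumes A: "A \<in> flats M" and B: "B \<in> flats M" and "A \<subseteq> B"
  shows "F \<in> interval_in (flats M) A B \<Longrightarrow>
    mobius (flats (minor M B A)) {} (F - A) = mobius (flats M) A F"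
proof (induction "card F" arbitrary: F rule: less_induct)
  case less
  let ?N = "flats (minor M B A)"
  have F: "F \<in> flats M" "A \<subseteq> F" "F \<subseteq> B" using less.prems unfolding interval_in_def by auto
  have fin: "finite F" using finite_flat F by blast
  show ?case
  proof (cases "F = A")
    case False
    then have ne: "{} \<subset> F - A" "A \<subset> F" using F by auto
    have im: "{G \<in> ?N. {} \<subseteq> G \<and> G \<subset> F - A} = (\<lambda>G. G - A) ` {G \<in> flats M. A \<subseteq> G \<and> G \<subset> F}"
    proof (intro equalityI subsetI)
      fix H assume "H \<in> {G \<in> ?N. {} \<subseteq> G \<and> G \<subset> F - A}"
      then obtain G where G: "G \<in> flats M" "A \<subseteq> G" "G - A \<subset> F - A" "H = G - A"
        unfolding flats_minor[OF A B assms(3)] by blast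
      have "G \<subseteq> F"
      proof
        fix x assume "x \<in> G"
        then show "x \<in> F" using G(3) F(2) by (cases "x \<in> A") auto
      qed
      moreover have "G \<noteq> F" using G(3) by auto
      ultimately have "G \<subset> F" by simp
      with G show "H \<in> (\<lambda>G. G - A) ` {G \<in> flats M. A \<subseteq> G \<and> G \<subset> F}" by blast
    next
      fix H assume "H \<in> (\<lambda>G. G - A) ` {G \<in> flats M. A \<subseteq> G \<and> G \<subset> F}"
      then obtain G where G: "G \<in> flats M" "A \<subseteq> G" "G \<subset> F" "H = G - A" by blast
      have "G - A \<subset> F - A" using G(2,3) by blast
      moreover have "G \<subseteq> B" using G(3) F(3) by simp
      ultimately show "H \<in> {G \<in> ?N. {} \<subseteq> G \<and> G \<subset> F - A}"
        unfolding flats_minor[OF A B assms(3)] using G by blast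
    qed
    have inj: "inj_on (\<lambda>G. G - A) {G \<in> flats M. A \<subseteq> G \<and> G \<subset> F}"
      by (rule inj_on_inverseI[where g = "\<lambda>G. G \<union> A"]) auto
    have "mobius ?N {} (F - A) = - (\<Sum>G\<in>{G \<in> ?N. {} \<subseteq> G \<and> G \<subset> F - A}. mobius ?N {} G)"
      using ne fin by (subst mobius.simps) auto
    also have "(\<Sum>G\<in>{G \<in> ?N. {} \<subseteq> G \<and> G \<subset> F - A}. mobius ?N {} G) =
        (\<Sum>G\<in>{G \<in> flats M. A \<subseteq> G \<and> G \<subset> F}. mobius ?N {} (G - A))"
      unfolding im sum.reindex[OF inj] by simp
    also have "\<dots> = (\<Sum>G\<in>{G \<in> flats M. A \<subseteq> G \<and> G \<subset> F}. mobius (flats M) A G)"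
    proof (rule sum.cong[OF refl])
      fix G assume "G \<in> {G \<in> flats M. A \<subseteq> G \<and> G \<subset> F}"
      then have "card G < card F" "G \<in> interval_in (flats M) A B"
        using F(3) psubset_card_mono[OF fin] unfolding interval_in_def by auto
      then show "mobius ?N {} (G - A) = mobius (flats M) A G" by (rule less.hyps)
    qed
    also have "- \<dots> = mobius (flats M) A F"
      using ne fin mobius.simps[of "flats M" A F] by auto
    finally show ?thesis .
  qed simp
qed

lemma beta_minor:
  assumes A: "A \<in> flats M" and B: "B \<in> flats M" and AB: "A \<subseteq> B"
  shows "beta (minor M B A) = (- 1) ^ (rk M B - rk M A) * signed_beta A B"
proof -
  let ?N = "minor M B A"
  have Bg: "B \<subseteq> ground M" using B flat_subset_ground by blast
  have rkN: "int (rk ?N (F - A)) = rk_between A F" if "F \<in> interval_in (flats M) A B" for F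
  proof -
    have "F - A \<union> A = F" "F - A \<subseteq> B - A" using that unfolding interval_in_def by auto
    then show ?thesis using rk_minor[OF AB Bg, of "F - A"] unfolding rk_between_def by simp
  qed
  have "inj_on (\<lambda>F. F - A) (interval_in (flats M) A B)"
    by (rule inj_on_inverseI[where g = "\<lambda>G. G \<union> A"]) (auto simp: interval_in_def)
  then have "(\<Sum>F\<in>flats ?N. mobius (flats ?N) {} F * int (rk ?N F)) =
      (\<Sum>F\<in>interval_in (flats M) A B. mobius (flats ?N) {} (F - A) * int (rk ?N (F - A)))"
    unfolding flats_minor[OF A B AB] interval_in_def[symmetric] by (subst sum.reindex) auto
  also have "\<dots> = signed_beta A B"
    unfolding signed_beta_def using mobius_minor[OF A B AB] rkN by (intro sum.cong) auto
  moreover have "matroid_rank ?N = rk M B - rk M A"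
    using rk_minor[OF AB Bg, of "B - A"] AB
    unfolding matroid_rank_def ground_minor by (simp add: Un_absorb2)
  ultimately show ?thesis
    unfolding beta_def using loopless_minor[OF A AB Bg] by simp
qed

text \<open>Both sides expand the product of a row with the matrix \<open>\<zeta> P\<^sub>e \<mu>\<close>, where \<open>P\<^sub>e\<close> is the
  projection onto the flats containing \<open>e\<close>: by Moebius inversion it is the matrix of the map
  sending \<open>H\<close> to the flat spanned by \<open>H\<close> and \<open>e\<close>.\<close>

lemma sum_join:
  fixes f g :: "'a set \<Rightarrow> int"
  assumes B: "B \<in> flats M" and e: "e \<in> B"
  shows "(\<Sum>H\<in>interval_in (flats M) A B. f H * g (matroid_closure (insert e H))) =
    (\<Sum>F\<in>{F \<in> interval_in (flats M) A B. e \<in> F}. (\<Sum>H\<in>interval_in (flats M) A F. f H) *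
      (\<Sum>K\<in>interval_in (flats M) F B. mobius (flats M) F K * g K))"
proof -
  let ?L = "flats M"
  let ?I = "interval_in ?L A B"
  let ?E = "{F \<in> ?I. e \<in> F}"
  let ?t = "\<lambda>H F K. f H * (mobius ?L F K * g K)"
  have fI: "finite ?I" using finite_interval_in[OF finite_flats] .
  \<comment> \<open>The flats containing both \<open>H\<close> and \<open>e\<close> are those above
    the join, so the sum runs over an interval with fixed upper end \<open>K\<close> and collapses
    by \<open>sum_mobius_upper\<close>.\<close>
  have inner: "(\<Sum>F\<in>{F \<in> {F \<in> ?E. H \<subseteq> F}. F \<subseteq> K}. mobius ?L F K) =
      (if matroid_closure (insert e H) = K then 1 else 0)" if "H \<in> ?I" "K \<in> ?I" for H K
  proof -
    have sub: "insert e H \<subseteq> ground M"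
      using that e B flat_subset_ground unfolding interval_in_def by auto
    have "{F \<in> {F \<in> ?E. H \<subseteq> F}. F \<subseteq> K} = interval_in ?L (matroid_closure (insert e H)) K"
      using that closure_subset_flat_iff[OF sub] unfolding interval_in_def by auto
    moreover have "(\<Sum>F\<in>interval_in ?L (matroid_closure (insert e H)) K. mobius ?L F K) =
        (if matroid_closure (insert e H) = K then 1 else 0)"
    proof (cases "matroid_closure (insert e H) \<subseteq> K")
      case True
      then show ?thesis
        using sum_mobius_upper[OF finite_flats finite_flat closure_flat[OF sub], of K] that
        unfolding interval_in_def by auto
    next
      case False
      then have "interval_in ?L (matroid_closure (insert e H)) K = {}" unfolding interval_in_def by auto
      then show ?thesis using False by auto
    qed
    ultimately show ?thesis by simp
  qed
  have mem: "matroid_closure (insert e H) \<in> ?I" if "H \<in> ?I" for H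
  proof -
    have sub: "insert e H \<subseteq> ground M" "insert e H \<subseteq> B"
      using that e B flat_subset_ground unfolding interval_in_def by auto
    then show ?thesis
      using closure_flat[OF sub(1)] subset_closure[OF sub(1)] closure_subset_flat[OF sub(2) B] that
      unfolding interval_in_def by auto
  qed
  have "(\<Sum>F\<in>?E. (\<Sum>H\<in>interval_in ?L A F. f H) * (\<Sum>K\<in>interval_in ?L F B. mobius ?L F K * g K)) =
      (\<Sum>F\<in>?E. \<Sum>H\<in>{H \<in> ?I. H \<subseteq> F}. \<Sum>K\<in>{K \<in> ?I. F \<subseteq> K}. ?t H F K)"
  proof (rule sum.cong[OF refl])
    fix F assume "F \<in> ?E"
    then have "A \<subseteq> F" "F \<subseteq> B" unfolding interval_in_def by auto
    then show "(\<Sum>H\<in>interval_in ?L A F. f H) * (\<Sum>K\<in>interval_in ?L F B. mobius ?L F K * g K) =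
        (\<Sum>H\<in>{H \<in> ?I. H \<subseteq> F}. \<Sum>K\<in>{K \<in> ?I. F \<subseteq> K}. ?t H F K)"
      by (simp only: interval_in_above[of A F] interval_in_below[of F B] sum_product)
  qed
  also have "\<dots> = (\<Sum>H\<in>?I. \<Sum>F\<in>{F \<in> ?E. H \<subseteq> F}. \<Sum>K\<in>{K \<in> ?I. F \<subseteq> K}. ?t H F K)"
    using fI by (intro sum.swap_restrict) auto
  also have "\<dots> = (\<Sum>H\<in>?I. \<Sum>K\<in>?I. \<Sum>F\<in>{F \<in> {F \<in> ?E. H \<subseteq> F}. F \<subseteq> K}. ?t H F K)"
    using fI by (intro sum.cong refl sum.swap_restrict) auto
  also have "\<dots> = (\<Sum>H\<in>?I. \<Sum>K\<in>?I. f H * ((if matroid_closure (insert e H) = K then 1 else 0) * g K))"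
    by (intro sum.cong refl) (simp only: sum_distrib_left[symmetric] sum_distrib_right[symmetric] inner)
  also have "\<dots> = (\<Sum>H\<in>?I. f H * g (matroid_closure (insert e H)))"
  proof (rule sum.cong[OF refl])
    fix H assume "H \<in> ?I"
    then have "(\<Sum>K\<in>?I. (if matroid_closure (insert e H) = K then 1 else 0) * g K) = g (matroid_closure (insert e H))"
      using mem fI by (simp add: if_distrib[of "\<lambda>x. x * _"] cong: if_cong)
    then show "(\<Sum>K\<in>?I. f H * ((if matroid_closure (insert e H) = K then 1 else 0) * g K)) = f H * g (matroid_closure (insert e H))"
      by (simp only: sum_distrib_left[symmetric])
  qed
  finally show ?thesis by simp
qed

text \<open>The point is that \<open>e\<close> does not occur on the right-hand side. The factor 2
  keeps the identity in the integers.\<close>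

lemma signed_beta_product_sum:
  assumes A: "A \<in> flats M" and B: "B \<in> flats M" and AB: "A \<subseteq> B" and e: "e \<in> B - A"
  defines "I \<equiv> interval_in (flats M) A B"
  shows "2 * (\<Sum>F\<in>{F \<in> I. e \<in> F}. signed_beta A F * signed_beta F B) =
    (\<Sum>H\<in>I. mobius (flats M) A H * (rk_between A H ^ 2 + rk_between A H)) -
    2 * rk_between A B * signed_beta A B"
proof -
  let ?L = "flats M"
  let ?r = "rk_between A"
  let ?m = "mobius ?L A"
  let ?E = "{F \<in> I. e \<in> F}"
  let ?j = "\<lambda>H. matroid_closure (insert e H)"
  have eB: "e \<in> B" "e \<notin> A" using e by auto
  have fI: "finite I" unfolding I_def using finite_interval_in[OF finite_flats] .
  \<comment> \<open>Ranks in the second factor are measured from \<open>A\<close> instead of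
    \<open>F\<close>, so that one function serves for all \<open>F\<close>. The shift is multiplied
    by a full Moebius sum and therefore survives only for \<open>F = B\<close>.\<close>
  have up: "signed_beta F B = (\<Sum>K\<in>interval_in ?L F B. mobius ?L F K * ?r K) - (if F = B then ?r B else 0)"
    if "F \<in> I" for F
  proof -
    have F: "F \<in> ?L" "F \<subseteq> B" using that unfolding I_def interval_in_def by auto
    have "signed_beta F B = (\<Sum>K\<in>interval_in ?L F B. mobius ?L F K * (?r K - ?r F))"
      unfolding signed_beta_def rk_between_def by (intro sum.cong) auto
    also have "\<dots> = (\<Sum>K\<in>interval_in ?L F B. mobius ?L F K * ?r K) -
        (\<Sum>K\<in>interval_in ?L F B. mobius ?L F K) * ?r F"
      by (simp add: right_diff_distrib sum_subtractf sum_distrib_right)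
    also have "(\<Sum>K\<in>interval_in ?L F B. mobius ?L F K) = (if F = B then 1 else 0)"
      by (rule sum_mobius_lower[OF finite_flats F(1) B F(2) finite_flat[OF B]])
    finally show ?thesis by simp
  qed
  have BE: "B \<in> ?E" using B AB eB unfolding I_def interval_in_def by auto
  have "(\<Sum>F\<in>?E. signed_beta A F * signed_beta F B) =
      (\<Sum>F\<in>?E. signed_beta A F * (\<Sum>K\<in>interval_in ?L F B. mobius ?L F K * ?r K)) -
      (\<Sum>F\<in>?E. signed_beta A F * (if F = B then ?r B else 0))"
    using up by (simp add: right_diff_distrib sum_subtractf)
  also have "(\<Sum>F\<in>?E. signed_beta A F * (if F = B then ?r B else 0)) = signed_beta A B * ?r B"
    using fI BE by (simp add: if_distrib cong: if_cong)
  also have "(\<Sum>F\<in>?E. signed_beta A F * (\<Sum>K\<in>interval_in ?L F B. mobius ?L F K * ?r K)) =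
      (\<Sum>H\<in>I. ?m H * ?r H * ?r (?j H))"
    unfolding signed_beta_def I_def
    by (rule sum_join[OF B eB(1), where f = "\<lambda>H. ?m H * ?r H", symmetric])
  finally have 1: "(\<Sum>F\<in>?E. signed_beta A F * signed_beta F B) =
      (\<Sum>H\<in>I. ?m H * ?r H * ?r (?j H)) - signed_beta A B * ?r B" .
  \<comment> \<open>Weisner's theorem\<close>
  have weisner: "(\<Sum>H\<in>I. ?m H * g (?j H)) = 0" for g
  proof -
    \<comment> \<open>This is where \<open>e \<notin> A\<close> enters: every \<open>F\<close>
      containing \<open>e\<close> differs from \<open>A\<close>.\<close>
    have "(\<Sum>H\<in>interval_in ?L A F. ?m H) = 0" if "F \<in> ?E" for F
    proof -
      have F: "F \<in> ?L" "A \<subseteq> F" "A \<noteq> F" using that eB unfolding I_def interval_in_def by auto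
      show ?thesis
        using sum_mobius_lower[OF finite_flats A F(1,2) finite_flat[OF F(1)]] F(3) by simp
    qed
    then show ?thesis unfolding I_def using sum_join[OF B eB(1), of ?m g A] by (simp add: I_def)
  qed
  have "2 * (\<Sum>H\<in>I. ?m H * ?r H * ?r (?j H)) =
      (\<Sum>H\<in>I. ?m H * (?r H ^ 2 + ?r H) + ?m H * (?r (?j H) ^ 2 - ?r (?j H)))"
    unfolding sum_distrib_left
  proof (rule sum.cong[OF refl])
    fix H assume "H \<in> I"
    then have H: "H \<in> ?L" "insert e H \<subseteq> ground M" "e \<in> ground M"
      using eB B flat_subset_ground unfolding I_def interval_in_def by auto
    \<comment> \<open>With r and s the ranks of \<open>H\<close> and of its join with
      \<open>e\<close>, the difference s - r equals its own square, which rearranges to 2rs = (r^2 +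
      r) + (s^2 - s).\<close>
    have "?r (?j H) = ?r H \<or> ?r (?j H) = ?r H + 1"
      unfolding rk_between_def rk_closure[OF H(2)] rk_insert_flat[OF H(1,3)] by simp
    then show "2 * (?m H * ?r H * ?r (?j H)) =
        ?m H * (?r H ^ 2 + ?r H) + ?m H * (?r (?j H) ^ 2 - ?r (?j H))"
      by (auto simp: algebra_simps power2_eq_square)
  qed
  also have "\<dots> = (\<Sum>H\<in>I. ?m H * (?r H ^ 2 + ?r H))"
    unfolding sum.distrib using weisner[of "\<lambda>K. ?r K ^ 2 - ?r K"] by simp
  finally show ?thesis using 1 by (simp add: algebra_simps)
qed

text \<open>The signs of the two beta invariants multiply to one that depends only on
  \<open>A\<close> and \<open>B\<close>. The value \<open>c\<close> stays anonymous because
  balancing only uses that it is the same for all \<open>e\<close>.\<close>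

lemma beta_product_sum:
  assumes A: "A \<in> flats M" and B: "B \<in> flats M" and AB: "A \<subseteq> B"
  obtains c where "\<And>e. e \<in> B - A \<Longrightarrow>
    (\<Sum>F\<in>{F \<in> flats M. A \<subset> F \<and> F \<subset> B \<and> e \<in> F}. beta (minor M F A) * beta (minor M B F)) = c"
proof -
  let ?I = "interval_in (flats M) A B"
  let ?s = "(- 1) ^ (rk M B - rk M A) :: int"
  define S where "S e = (\<Sum>F\<in>{F \<in> ?I. e \<in> F}. signed_beta A F * signed_beta F B)" for e
  have S: "S e = S e'" if "e \<in> B - A" "e' \<in> B - A" for e e'
    using signed_beta_product_sum[OF A B AB that(1)] signed_beta_product_sum[OF A B AB that(2)]
    unfolding S_def by simp
  have "(\<Sum>F\<in>{F \<in> flats M. A \<subset> F \<and> F \<subset> B \<and> e \<in> F}. beta (minor M F A) * beta (minor M B F)) = ?s * S e" for e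
  proof -
    have "(\<Sum>F\<in>{F \<in> flats M. A \<subset> F \<and> F \<subset> B \<and> e \<in> F}. beta (minor M F A) * beta (minor M B F)) =
        (\<Sum>F\<in>{F \<in> flats M. A \<subset> F \<and> F \<subset> B \<and> e \<in> F}. ?s * (signed_beta A F * signed_beta F B))"
    proof (rule sum.cong[OF refl])
      fix F assume "F \<in> {F \<in> flats M. A \<subset> F \<and> F \<subset> B \<and> e \<in> F}"
      then have F: "F \<in> flats M" "A \<subseteq> F" "F \<subseteq> B" by auto
      have "rk M B - rk M A = (rk M F - rk M A) + (rk M B - rk M F)"
        using rk_mono[OF F(2)] rk_mono[OF F(3)] by simp
      then show "beta (minor M F A) * beta (minor M B F) = ?s * (signed_beta A F * signed_beta F B)"
        using beta_minor[OF A F(1,2)] beta_minor[OF F(1) B F(3)] by (simp add: power_add)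
    qed
    \<comment> \<open>The ends \<open>F = A\<close> and \<open>F = B\<close> may be included, since
      \<open>signed_beta\<close> vanishes on trivial intervals.\<close>
    also have "\<dots> = (\<Sum>F\<in>{F \<in> ?I. e \<in> F}. ?s * (signed_beta A F * signed_beta F B))"
      using finite_flats by (intro sum.mono_neutral_left) (auto simp: interval_in_def)
    finally show ?thesis unfolding S_def by (simp add: sum_distrib_left)
  qed
  then show thesis using that S by metis
qed

end


section \<open>Convex cones and their faces\<close>

lemma convex_cone_face_of:
  fixes C :: "'v::real_vector set"
  assumes C: "convex_cone C" and F: "F face_of C" "F \<noteq> {}"
  shows "convex_cone F"
proof -
  have sub: "F \<subseteq> C" and conv: "convex F"
    and face: "\<And>a b x. \<lbrakk>a \<in> C; b \<in> C; x \<in> F; x \<in> open_segment a b\<rbrakk> \<Longrightarrow> a \<in> F \<and> b \<in> F"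
    using F unfolding face_of_def by blast+
  \<comment> \<open>The point \<open>x\<close> lies strictly between 0 and (c + 1) x, so the face
    contains both ends. The multiple c + 1 instead of c keeps \<open>x\<close> off the end of the
    segment when c = 1.\<close>
  have scale: "0 \<in> F \<and> c *\<^sub>R x \<in> F" if "x \<in> F" "c \<ge> 1" for c :: real and x
  proof (cases "x = 0")
    case False
    have "x \<in> open_segment 0 ((c + 1) *\<^sub>R x)"
      unfolding in_segment using False that(2)
      by (intro conjI exI[of _ "1 / (c + 1)"]) auto
    then have 0: "0 \<in> F" "(c + 1) *\<^sub>R x \<in> F"
      using face[of 0 "(c + 1) *\<^sub>R x" x] that sub C by (auto simp: convex_cone_iff)
    have "(1 - c / (c + 1)) *\<^sub>R 0 + (c / (c + 1)) *\<^sub>R ((c + 1) *\<^sub>R x) \<in> F"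
      using that(2) by (intro convexD_alt[OF conv 0]) auto
    moreover have "c / (c + 1) * (c + 1) = c" using that(2) by simp
    ultimately show ?thesis using 0 by simp
  qed (use that in simp)
  have 0: "0 \<in> F" using scale[of _ 1] F(2) by auto
  have scale': "c *\<^sub>R x \<in> F" if "x \<in> F" "c \<ge> 0" for c :: real and x
  proof (cases "c \<ge> 1")
    case False
    then have "(1 - c) *\<^sub>R 0 + c *\<^sub>R x \<in> F"
      using that by (intro convexD_alt[OF conv 0]) auto
    then show ?thesis by simp
  qed (use scale that in blast)
  have "x + y \<in> F" if "x \<in> F" "y \<in> F" for x y
  proof -
    have "(1 - 1/2) *\<^sub>R (2 *\<^sub>R x) + (1/2) *\<^sub>R (2 *\<^sub>R y) \<in> F"
      using scale'[of x 2] scale'[of y 2] that by (intro convexD_alt[OF conv]) auto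
    then show ?thesis by simp
  qed
  then show ?thesis using 0 scale' unfolding convex_cone_iff by blast
qed

text \<open>The sum is the midpoint of 2x and 2y, to which the face property applies. For x = y that
  segment has no interior, hence the separate case.\<close>

lemma face_of_convex_cone_summand:
  fixes C :: "'v::real_vector set"
  assumes C: "convex_cone C" and F: "F face_of C" and xy: "x \<in> C" "y \<in> C" "x + y \<in> F"
  shows "x \<in> F"
proof -
  have cF: "convex_cone F" using convex_cone_face_of[OF C F] xy by blast
  have half: "x \<in> F" if "2 *\<^sub>R x \<in> F"
    using convex_cone_scaleR[OF cF, of "1/2" "2 *\<^sub>R x"] that by simp
  show ?thesis
  proof (cases "x = y")
    case True
    then show ?thesis using half xy by (simp add: scaleR_2)
  next
    case False
    then have "x + y \<in> open_segment (2 *\<^sub>R x) (2 *\<^sub>R y)"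
      unfolding in_segment by (intro conjI exI[of _ "1/2"]) auto
    moreover have "2 *\<^sub>R x \<in> C" "2 *\<^sub>R y \<in> C"
      using xy C by (auto simp: convex_cone_iff)
    ultimately have "2 *\<^sub>R x \<in> F" using face_ofD[OF F] xy(3) by blast
    then show ?thesis by (rule half)
  qed
qed

text \<open>The points of the cone that satisfy the claim form a convex cone: if a sum lies in the
  face, so do its summands. This cone contains the generators, hence everything.\<close>

lemma face_of_convex_cone_hull:
  fixes S :: "'v::real_vector set"
  assumes F: "F face_of (convex_cone hull S)" "F \<noteq> {}"
  shows "F = convex_cone hull (S \<inter> F)"
proof
  let ?C = "convex_cone hull S"
  have C: "convex_cone ?C" by (rule convex_cone_convex_cone_hull)
  have cF: "convex_cone F" by (rule convex_cone_face_of[OF C F])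
  show "convex_cone hull (S \<inter> F) \<subseteq> F" using cF by (intro hull_minimal) auto
  let ?D = "{x \<in> ?C. x \<in> F \<longrightarrow> x \<in> convex_cone hull (S \<inter> F)}"
  have "convex_cone ?D"
  proof (rule iffD2[OF convex_cone_iff], intro conjI ballI allI impI)
    show "0 \<in> ?D" by (simp add: convex_cone_hull_contains_0)
  next
    fix x y assume x: "x \<in> ?D" and y: "y \<in> ?D"
    have "x + y \<in> convex_cone hull (S \<inter> F)" if "x + y \<in> F"
    proof -
      have "x \<in> F" "y \<in> F"
        using face_of_convex_cone_summand[OF C F(1), of x y]
          face_of_convex_cone_summand[OF C F(1), of y x] x y that by (auto simp: add.commute)
      then show ?thesis using x y by (auto intro: convex_cone_hull_add)
    qed
    then show "x + y \<in> ?D" using x y by (auto intro: convex_cone_hull_add)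
  next
    fix x and c :: real assume x: "x \<in> ?D" and c: "c \<ge> 0"
    have "c *\<^sub>R x \<in> convex_cone hull (S \<inter> F)" if cx: "c *\<^sub>R x \<in> F"
    proof (cases "c = 0")
      case True
      then show ?thesis by (simp add: convex_cone_hull_contains_0)
    next
      case False
      then have "x \<in> F" using convex_cone_scaleR[OF cF, of "1 / c" "c *\<^sub>R x"] cx c by simp
      then show ?thesis using x c by (auto intro: convex_cone_hull_mul)
    qed
    then show "c *\<^sub>R x \<in> ?D" using x c by (auto intro: convex_cone_hull_mul)
  qed
  moreover have "S \<subseteq> ?D" by (auto intro: hull_inc)
  ultimately have "?C \<subseteq> ?D" by (intro hull_minimal) auto
  then show "F \<subseteq> convex_cone hull (S \<inter> F)" using F(1) unfolding face_of_def by blast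
qed

lemma span_convex_cone_hull: "span (convex_cone hull S) = span S"
proof
  have "convex_cone (span S)"
    unfolding convex_cone_iff by (auto intro: span_add span_scale span_zero)
  then have "convex_cone hull S \<subseteq> span S" by (intro hull_minimal span_superset) auto
  then show "span (convex_cone hull S) \<subseteq> span S" by (intro span_minimal) auto
  show "span S \<subseteq> span (convex_cone hull S)" by (intro span_mono hull_subset)
qed

section \<open>Unimodular sets of lattice vectors\<close>

text \<open>Treats real vector spaces as modules over the integers:
  \<open>int_module.subspace\<close> means additive subgroup, and the general span lemmas become
  available for \<open>int_span\<close>.\<close>

interpretation int_module: module "\<lambda>(m::int) (x::'v::real_vector). of_int m *\<^sub>R x"
  rewrites "module.span (\<lambda>(m::int) (x::'v). of_int m *\<^sub>R x) = int_span"
  by unfold_locales (simp_all add: algebra_simps int_span_def)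

text \<open>Integral dual functionals certify that \<open>S\<close> is a lattice basis of
  \<open>span S \<inter> \<Lambda>\<close>: the coefficients of a lattice vector of the span are its
  values under the functionals, hence integers.\<close>

locale unimodular =
  fixes \<Lambda> :: "'v::real_vector set" and S :: "'v set" and \<phi> :: "'v \<Rightarrow> 'v \<Rightarrow> real"
  assumes finite_S: "finite S" and S_lattice: "S \<subseteq> \<Lambda>"
    and lattice: "int_module.subspace \<Lambda>"
    and linear_\<phi>: "s \<in> S \<Longrightarrow> linear (\<phi> s)"
    and \<phi>_dual: "s \<in> S \<Longrightarrow> t \<in> S \<Longrightarrow> \<phi> s t = (if s = t then 1 else 0)"
    and \<phi>_Ints: "s \<in> S \<Longrightarrow> x \<in> \<Lambda> \<Longrightarrow> \<phi> s x \<in> \<int>"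
begin

lemma representation:
  assumes "T \<subseteq> S" "x \<in> span T"
  shows "x = (\<Sum>t\<in>T. \<phi> t x *\<^sub>R t)"
proof -
  have fT: "finite T" using assms(1) finite_S finite_subset by blast
  obtain u where u: "x = (\<Sum>t\<in>T. u t *\<^sub>R t)"
    using assms(2) unfolding span_finite[OF fT] by auto
  have "\<phi> s x = u s" if "s \<in> T" for s
  proof -
    have s: "s \<in> S" using that assms(1) by blast
    have "\<phi> s x = (\<Sum>t\<in>T. u t * \<phi> s t)"
      unfolding u linear_sum[OF linear_\<phi>[OF s]] linear_scale[OF linear_\<phi>[OF s]] by simp
    also have "\<dots> = (\<Sum>t\<in>T. if s = t then u t else 0)"
      using \<phi>_dual[OF s] assms(1) by (intro sum.cong) auto
    finally show ?thesis using fT that by simp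
  qed
  then show ?thesis using u by simp
qed

lemma \<phi>_span_zero:
  assumes "s \<in> S" "x \<in> span (S - {s})"
  shows "\<phi> s x = 0"
proof -
  have "\<phi> s x = \<phi> s (\<Sum>t\<in>S - {s}. \<phi> t x *\<^sub>R t)" using representation[of "S - {s}" x] assms by simp
  also have "\<dots> = (\<Sum>t\<in>S - {s}. \<phi> t x * \<phi> s t)"
    unfolding linear_sum[OF linear_\<phi>[OF assms(1)]] linear_scale[OF linear_\<phi>[OF assms(1)]] by simp
  also have "\<dots> = 0" using \<phi>_dual assms(1) by (intro sum.neutral) auto
  finally show ?thesis .
qed

lemma independent_S: "independent S"
proof -
  have "s \<notin> span (S - {s})" if "s \<in> S" for s
    using \<phi>_span_zero[OF that, of s] \<phi>_dual[OF that that] by auto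
  then show ?thesis unfolding dependent_def by blast
qed

lemma dim_cone: "dim (convex_cone hull S) = card S"
  by (rule dim_eq_card) (simp_all add: span_convex_cone_hull independent_S)

lemma span_remove:
  assumes "s \<in> S" "x \<in> span S" "\<phi> s x = 0"
  shows "x \<in> span (S - {s})"
proof -
  have "x = \<phi> s x *\<^sub>R s + (\<Sum>t\<in>S - {s}. \<phi> t x *\<^sub>R t)"
    using representation[OF order_refl assms(2)] sum.remove[OF finite_S assms(1), of "\<lambda>t. \<phi> t x *\<^sub>R t"]
    by simp
  then have "x = (\<Sum>t\<in>S - {s}. \<phi> t x *\<^sub>R t)" using assms(3) by simp
  also have "\<dots> \<in> span (S - {s})" by (intro span_sum span_scale span_base)
  finally show ?thesis .
qed

lemma \<phi>_cone_nonneg: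
  assumes "s \<in> S" "x \<in> convex_cone hull S"
  shows "\<phi> s x \<ge> 0"
proof -
  have "convex_cone {x. \<phi> s x \<ge> 0}"
    unfolding convex_cone_iff
    using linear_0[OF linear_\<phi>[OF assms(1)]] linear_add[OF linear_\<phi>[OF assms(1)]]
      linear_scale[OF linear_\<phi>[OF assms(1)]] by simp
  moreover have "S \<subseteq> {x. \<phi> s x \<ge> 0}" using \<phi>_dual[OF assms(1)] by auto
  ultimately have "convex_cone hull S \<subseteq> {x. \<phi> s x \<ge> 0}" by (intro hull_minimal) auto
  then show ?thesis using assms(2) by blast
qed

text \<open>Subtracting from a lattice vector \<open>x\<close> the integer multiple
  \<open>\<phi> s x\<close> of \<open>s\<close> leaves a lattice vector on which
  \<open>\<phi> s\<close> vanishes, that is, one in the span of the facet.\<close>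

lemma generator_lattice_normal:
  assumes s: "s \<in> S"
  shows "s \<in> lattice_normals \<Lambda> (convex_cone hull (S - {s})) (convex_cone hull S)"
proof -
  let ?T = "S - {s}"
  have sL: "s \<in> \<Lambda>" using S_lattice s by blast
  have subgroup: "int_module.subspace (span S \<inter> \<Lambda>)"
    using lattice span_add span_scale span_zero unfolding int_module.subspace_def by auto
  have "insert s (span ?T \<inter> \<Lambda>) \<subseteq> span S \<inter> \<Lambda>"
    using s sL span_mono[of ?T S] span_base[OF s] by auto
  then have 1: "int_span (insert s (span ?T \<inter> \<Lambda>)) \<subseteq> span S \<inter> \<Lambda>"
    by (rule int_module.span_minimal[OF _ subgroup])
  have 2: "x \<in> int_span (insert s (span ?T \<inter> \<Lambda>))" if x: "x \<in> span S \<inter> \<Lambda>" for x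
  proof -
    obtain m where m: "\<phi> s x = of_int m" using \<phi>_Ints[OF s, of x] x by (auto elim: Ints_cases)
    have mL: "x - of_int m *\<^sub>R s \<in> span S \<inter> \<Lambda>"
      using int_module.subspace_diff[OF subgroup] int_module.subspace_scale[OF subgroup] x s sL
      by (simp add: span_base)
    have "\<phi> s (x - of_int m *\<^sub>R s) = 0"
      using \<phi>_dual[OF s s] m
      by (simp add: linear_diff[OF linear_\<phi>[OF s]] linear_scale[OF linear_\<phi>[OF s]])
    then have "x - of_int m *\<^sub>R s \<in> span ?T \<inter> \<Lambda>" using span_remove[OF s] mL by blast
    then show ?thesis
      unfolding int_module.span_breakdown_eq using int_module.span_base by blast
  qed
  have 3: "s + 0 \<in> convex_cone hull S" using s by (simp add: hull_inc)
  show ?thesis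
    unfolding lattice_normals_def span_convex_cone_hull
    using 1 2 3 sL span_zero by blast
qed

text \<open>Generating the lattice forces \<open>\<phi> s v\<close> to be a unit of the integers,
  and pointing into the cone makes it nonnegative; so it is 1, the same value as for
  \<open>s\<close>.\<close>

lemma lattice_normal_unique:
  assumes s: "s \<in> S"
    and v: "v \<in> lattice_normals \<Lambda> (convex_cone hull (S - {s})) (convex_cone hull S)"
  shows "v - s \<in> span (S - {s})"
proof -
  let ?T = "S - {s}"
  note lin = linear_\<phi>[OF s]
  obtain l where l: "l \<in> span ?T" "v + l \<in> convex_cone hull S"
    and vL: "v \<in> \<Lambda>" and gen: "int_span (insert v (span ?T \<inter> \<Lambda>)) = span S \<inter> \<Lambda>"
    using v unfolding lattice_normals_def span_convex_cone_hull by blast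
  have subgroup: "int_module.subspace (span ?T \<inter> \<Lambda>)"
    using lattice span_add span_scale span_zero unfolding int_module.subspace_def by auto
  have vS: "v \<in> span S"
    using int_module.span_base[of v "insert v (span ?T \<inter> \<Lambda>)"] gen by auto
  have "s \<in> int_span (insert v (span ?T \<inter> \<Lambda>))"
    unfolding gen using s S_lattice by (auto intro: span_base)
  then obtain m :: int where "s - of_int m *\<^sub>R v \<in> int_span (span ?T \<inter> \<Lambda>)"
    unfolding int_module.span_breakdown_eq by blast
  then have "s - of_int m *\<^sub>R v \<in> span ?T"
    using int_module.span_minimal[OF order_refl subgroup] by blast
  then have "\<phi> s (s - of_int m *\<^sub>R v) = 0" by (rule \<phi>_span_zero[OF s])
  then have "of_int m * \<phi> s v = 1"
    using \<phi>_dual[OF s s] by (simp add: linear_diff[OF lin] linear_scale[OF lin])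
  moreover obtain n where n: "\<phi> s v = of_int n" using \<phi>_Ints[OF s vL] by (auto elim: Ints_cases)
  ultimately have "of_int (m * n) = (1::real)" by simp
  then have "m * n = 1" by linarith
  moreover have "\<phi> s v \<ge> 0"
    using \<phi>_cone_nonneg[OF s l(2)] \<phi>_span_zero[OF s l(1)] by (simp add: linear_add[OF lin])
  then have "n \<ge> 0" using n by simp
  ultimately have "n = 1" using zmult_eq_1_iff by auto
  then have "\<phi> s (v - s) = 0"
    using n \<phi>_dual[OF s s] by (simp add: linear_diff[OF lin])
  moreover have "v - s \<in> span S" using vS s by (intro span_diff) (auto intro: span_base)
  ultimately show ?thesis by (intro span_remove[OF s])
qed

end


section \<open>Cones over chains of sets\<close>

lemma chain_subset_Union_mem:
  assumes "finite C" "C \<noteq> {}" "chain_subset C"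
  shows "\<Union>C \<in> C"
proof -
  obtain m where m: "m \<in> C" "\<forall>b\<in>C. m \<subseteq> b \<longrightarrow> m = b"
    using finite_has_maximal[OF assms(1,2)] by blast
  then have "b \<subseteq> m" if "b \<in> C" for b
    using assms(3) that unfolding chain_subset_def by blast
  then have "\<Union>C = m" using m(1) by blast
  then show ?thesis using m(1) by simp
qed

lemma chain_subset_Inter_mem:
  assumes "finite C" "C \<noteq> {}" "chain_subset C"
  shows "\<Inter>C \<in> C"
proof -
  obtain m where m: "m \<in> C" "\<forall>b\<in>C. b \<subseteq> m \<longrightarrow> m = b"
    using finite_has_minimal[OF assms(1,2)] by blast
  then have "m \<subseteq> b" if "b \<in> C" for b
    using assms(3) that unfolding chain_subset_def by blast
  then have "\<Inter>C = m" using m(1) by blast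
  then show ?thesis using m(1) by simp
qed

lemma chain_subset_mono: "chain_subset S \<Longrightarrow> T \<subseteq> S \<Longrightarrow> chain_subset T"
  unfolding chain_subset_def by blast

section \<open>Coordinate differences as functionals on the quotient\<close>

lemma ind_vec_nth [simp]: "ind_vec S $ i = (if i \<in> S then 1 else 0)"
  unfolding ind_vec_def by (simp add: axis_def if_distrib cong: if_cong)

lemma span_ones: "x \<in> span {ind_vec UNIV} \<longleftrightarrow> (\<forall>i j. x $ i = x $ j)"
proof
  assume "x \<in> span {ind_vec UNIV}"
  then obtain c where "x = c *\<^sub>R ind_vec UNIV" unfolding span_singleton by blast
  then show "\<forall>i j. x $ i = x $ j" by simp
next
  assume "\<forall>i j. x $ i = x $ j"
  then have "x = (x $ undefined) *\<^sub>R ind_vec UNIV" by (simp add: vec_eq_iff)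
  then show "x \<in> span {ind_vec UNIV}" by (metis span_base span_scale singletonI)
qed

text \<open>Single coordinates do not descend to the quotient by the all-ones vector, but their
  differences do. They separate points and are integral on the lattice, so they serve both for
  inequalities and as dual functionals.\<close>

lift_definition coord_diff :: "'e::finite \<Rightarrow> 'e \<Rightarrow> 'e torus \<Rightarrow> real" is "\<lambda>i j x. x $ i - x $ j"
proof -
  fix i j and x y :: "real ^ 'e"
  assume "x - y \<in> span {ind_vec UNIV}"
  then have "(x - y) $ i = (x - y) $ j" unfolding span_ones by blast
  then show "x $ i - x $ j = y $ i - y $ j" by simp
qed

lemma torus_eqI:
  assumes "\<And>i j. coord_diff i j x = coord_diff i j y"
  shows "x = y"
  using assms
proof transfer
  fix x y :: "real ^ 'e"
  assume "\<And>i j. x $ i - x $ j = y $ i - y $ j"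
  then have "(x - y) $ i = (x - y) $ j" for i j
    by (simp add: algebra_simps)
  then show "x - y \<in> span {ind_vec UNIV}" unfolding span_ones by blast
qed

lemma linear_coord_diff: "linear (coord_diff i j)"
  by (rule linearI; transfer; simp add: algebra_simps)

lemmas coord_diff_simps [simp] =
  linear_add[OF linear_coord_diff] linear_scale[OF linear_coord_diff]
  linear_0[OF linear_coord_diff]

lemma linear_torus_proj: "linear torus_proj"
  by (rule linearI) (simp_all add: plus_torus.abs_eq scaleR_torus.abs_eq)

lemma coord_diff_torus_proj [simp]: "coord_diff i j (torus_proj x) = x $ i - x $ j"
  by (rule coord_diff.abs_eq)

definition set_vec :: "'e::finite set \<Rightarrow> 'e torus" where
  "set_vec F = torus_proj (ind_vec F)"

lemma coord_diff_set_vec [simp]: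
  "coord_diff i j (set_vec F) = (if i \<in> F then 1 else 0) - (if j \<in> F then 1 else 0)"
  unfolding set_vec_def by simp

lemma set_vec_trivial [simp]: "set_vec {} = 0" "set_vec UNIV = 0"
  by (rule torus_eqI; simp)+

lemma torus_lattice_subspace: "int_module.subspace torus_lattice"
proof (rule int_module.subspaceI)
  have lin: "torus_proj x + torus_proj y = torus_proj (x + y)"
    "c *\<^sub>R torus_proj x = torus_proj (c *\<^sub>R x)" for x y :: "real ^ 'a" and c
    using linear_add[OF linear_torus_proj] linear_scale[OF linear_torus_proj] by metis+
  show "0 \<in> torus_lattice"
    unfolding torus_lattice_def using linear_0[OF linear_torus_proj]
    by (intro image_eqI[of _ _ 0]) auto
  show "x + y \<in> torus_lattice" if "x \<in> torus_lattice" "y \<in> torus_lattice" for x y :: "'a torus"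
    using that unfolding torus_lattice_def by (auto simp: lin)
  show "of_int c *\<^sub>R x \<in> torus_lattice" if "x \<in> torus_lattice" for x :: "'a torus" and c :: int
    using that unfolding torus_lattice_def by (auto simp: lin)
qed

lemma set_vec_lattice: "set_vec F \<in> torus_lattice"
  unfolding set_vec_def torus_lattice_def by (intro imageI) simp

lemma coord_diff_lattice: "x \<in> torus_lattice \<Longrightarrow> coord_diff i j x \<in> \<int>"
  unfolding torus_lattice_def by auto

text \<open>The line of all-ones vectors is killed by the projection, so adding it beforehand does
  not change the image.\<close>

lemma chain_cone_eq: "chain_cone Fs = convex_cone hull (set_vec ` set Fs)"
proof -
  have zero: "torus_proj y = 0" if "y \<in> span {ind_vec UNIV}" for y :: "real ^ 'a"
  proof (rule torus_eqI)
    fix i j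
    have "y $ i = y $ j" using that unfolding span_ones by blast
    then show "coord_diff i j (torus_proj y) = coord_diff i j 0" by simp
  qed
  let ?C = "convex_cone hull (ind_vec ` set Fs)"
  have "chain_cone Fs = torus_proj ` ?C"
  proof (intro equalityI subsetI)
    fix z assume "z \<in> chain_cone Fs"
    then obtain x y where "z = torus_proj (x + y)" "x \<in> ?C" "y \<in> span {ind_vec UNIV}"
      unfolding chain_cone_def by blast
    then show "z \<in> torus_proj ` ?C"
      using linear_add[OF linear_torus_proj, of x y] zero[of y] by simp
  next
    fix z assume "z \<in> torus_proj ` ?C"
    then obtain x where "z = torus_proj (x + 0)" "x \<in> ?C" by auto
    then show "z \<in> chain_cone Fs" unfolding chain_cone_def using span_zero by blast
  qed
  then show ?thesis
    unfolding convex_cone_hull_linear_image[OF linear_torus_proj, symmetric]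
    by (simp add: image_image set_vec_def)
qed

text \<open>An inequality description of the cone over a chain, valid for chains only.\<close>

definition order_cone :: "'e::finite set set \<Rightarrow> 'e torus set" where
  "order_cone S = {x. \<forall>i j. (\<forall>F\<in>S. i \<in> F \<longrightarrow> j \<in> F) \<longrightarrow> coord_diff i j x \<le> 0}"

lemma order_cone_mono: "T \<subseteq> S \<Longrightarrow> order_cone T \<subseteq> order_cone S"
  unfolding order_cone_def by blast

lemma convex_cone_order_cone: "convex_cone (order_cone S)"
  unfolding convex_cone_iff order_cone_def
  by (auto intro: add_nonpos_nonpos mult_nonneg_nonpos)

text \<open>The superlevel set of a representative of \<open>x\<close> at the height of its
  coordinate \<open>k\<close>. A coordinate is used as threshold because a real number would have no
  meaning modulo the all-ones vector.\<close>

definition level_set :: "'e::finite torus \<Rightarrow> 'e \<Rightarrow> 'e set" where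
  "level_set x k = {i. coord_diff i k x \<ge> 0}"

lemma level_set_torus_proj: "level_set (torus_proj v) k = {i. v $ k \<le> v $ i}"
  unfolding level_set_def by simp

text \<open>The inequalities say that a coordinate in the level set is separated from one outside by
  a member of \<open>S\<close>. For each \<open>j\<close> outside, the largest member of the chain
  avoiding \<open>j\<close> therefore contains the level set; the intersection of these members
  equals it and is again a member.\<close>

lemma level_set_order_cone:
  assumes S: "chain_subset S" and x: "x \<in> order_cone S"
  shows "level_set x k \<in> insert UNIV S"
proof (cases "level_set x k = UNIV")
  case False
  let ?U = "level_set x k"
  let ?F = "\<lambda>j. \<Union>{F \<in> S. j \<notin> F}"
  have sep: "\<exists>F\<in>S. i \<in> F \<and> j \<notin> F" if "i \<in> ?U" "j \<notin> ?U" for i j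
  proof (rule ccontr)
    assume "\<not> ?thesis"
    then have "coord_diff i j x \<le> 0" using x unfolding order_cone_def by blast
    moreover have "coord_diff i k x = coord_diff i j x + coord_diff j k x" by transfer simp
    ultimately show False using that unfolding level_set_def by simp
  qed
  have "k \<in> ?U" unfolding level_set_def by (simp, transfer, simp)
  then have "?F j \<in> {F \<in> S. j \<notin> F}" if "j \<notin> ?U" for j
    using sep[of k j] that by (intro chain_subset_Union_mem chain_subset_mono[OF S]) auto
  then have mem: "?F j \<in> S" if "j \<notin> ?U" for j using that by blast
  have "\<Inter>(?F ` (- ?U)) \<in> ?F ` (- ?U)"
    using mem False by (intro chain_subset_Inter_mem chain_subset_mono[OF S]) auto
  moreover have "\<Inter>(?F ` (- ?U)) = ?U" using sep by auto
  ultimately show ?thesis using mem by auto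
qed simp

text \<open>Induction on the number of distinct coordinate values: peel off the top level set with
  the gap between the two largest values as coefficient.\<close>

lemma mem_cone_level_sets: "x \<in> convex_cone hull (set_vec ` range (level_set x))"
proof -
  have "torus_proj v \<in> convex_cone hull (set_vec ` range (\<lambda>k. {i. v $ k \<le> v $ i}))"
    for v :: "real ^ 'a"
  proof (induction "card (range (\<lambda>i. v $ i))" arbitrary: v rule: less_induct)
    case less
    let ?R = "range (\<lambda>i. v $ i)"
    let ?m = "Max ?R"
    have m: "?m \<in> ?R" "\<And>i. v $ i \<le> ?m" by (auto intro: Max_in Max_ge)
    obtain a where a: "v $ a = ?m" using imageE[OF m(1)] by metis
    show ?case
    proof (cases "?R = {?m}")
      case True
      then have "v $ i = v $ j" for i j by (metis rangeI singletonD)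
      then have "torus_proj v = 0" by (intro torus_eqI) simp
      then show ?thesis by (simp add: convex_cone_hull_contains_0)
    next
      case False
      then have ne: "?R - {?m} \<noteq> {}" using m(1) by blast
      let ?m' = "Max (?R - {?m})"
      have m': "?m' \<in> ?R - {?m}" using ne by (intro Max_in) auto
      then have lt: "?m' < ?m" using m(2) by (auto simp: order_less_le)
      have le: "v $ i \<le> ?m'" if "v $ i \<noteq> ?m" for i
        using that by (intro Max_ge) auto
      obtain b where b: "v $ b = ?m'" using imageE[OF DiffD1[OF m']] by metis
      let ?A = "{i. v $ a \<le> v $ i}"
      have A: "?A = {i. v $ i = ?m}" using a m(2) by (auto intro: antisym)
      \<comment> \<open>The largest value is lowered to the second largest, which merges the two top
        levels; the level sets that remain are level sets of \<open>v\<close>.\<close>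
      define w where "w = v - (?m - ?m') *\<^sub>R ind_vec ?A"
      have w: "w $ i = (if v $ i = ?m then ?m' else v $ i)" for i
        unfolding w_def A by simp
      have "range (\<lambda>i. w $ i) \<subseteq> ?R - {?m}"
        using m' by (auto simp only: w image_subset_iff Diff_iff split: if_split)
      then have "range (\<lambda>i. w $ i) \<subset> ?R" using m(1) by blast
      then have "card (range (\<lambda>i. w $ i)) < card ?R" by (intro psubset_card_mono) simp
      then have IH: "torus_proj w \<in> convex_cone hull (set_vec ` range (\<lambda>k. {i. w $ k \<le> w $ i}))"
        by (rule less.hyps)
      have lev: "{i. w $ k \<le> w $ i} \<in> range (\<lambda>k. {i. v $ k \<le> v $ i})" for k
      proof (cases "v $ k = ?m")
        case True
        then have "w $ k \<le> w $ i \<longleftrightarrow> v $ b \<le> v $ i" for i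
          using le[of i] lt b by (auto simp: w)
        then show ?thesis by blast
      next
        case False
        then have "w $ k \<le> w $ i \<longleftrightarrow> v $ k \<le> v $ i" for i
          using le[of k] lt by (auto simp: w)
        then show ?thesis by blast
      qed
      have "convex_cone hull (set_vec ` range (\<lambda>k. {i. w $ k \<le> w $ i})) \<subseteq>
          convex_cone hull (set_vec ` range (\<lambda>k. {i. v $ k \<le> v $ i}))"
        using lev by (intro hull_mono image_mono) blast
      then have "torus_proj w \<in> convex_cone hull (set_vec ` range (\<lambda>k. {i. v $ k \<le> v $ i}))"
        using IH by blast
      moreover have "set_vec ?A \<in> convex_cone hull (set_vec ` range (\<lambda>k. {i. v $ k \<le> v $ i}))"
        by (intro hull_inc) blast
      moreover have "torus_proj v = torus_proj w + (?m - ?m') *\<^sub>R set_vec ?A"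
        unfolding set_vec_def w_def
        by (simp add: linear_diff[OF linear_torus_proj] linear_scale[OF linear_torus_proj])
      ultimately show ?thesis
        using lt by (auto intro!: convex_cone_hull_add convex_cone_hull_mul)
    qed
  qed
  then have "torus_proj v \<in> convex_cone hull (set_vec ` range (level_set (torus_proj v)))" for v :: "real ^ 'a"
    unfolding level_set_torus_proj[abs_def] .
  then show ?thesis by (metis Quotient_abs_rep[OF Quotient_torus])
qed

lemma cone_of_level_sets:
  assumes "range (level_set x) \<subseteq> insert UNIV S"
  shows "x \<in> convex_cone hull (set_vec ` S)"
proof -
  have "set_vec ` range (level_set x) \<subseteq> convex_cone hull (set_vec ` S)"
  proof
    fix z assume "z \<in> set_vec ` range (level_set x)"
    then have "z \<in> set_vec ` insert UNIV S" using assms by blast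
    then show "z \<in> convex_cone hull (set_vec ` S)"
      by (auto simp: convex_cone_hull_contains_0 intro: hull_inc)
  qed
  then have "convex_cone hull (set_vec ` range (level_set x)) \<subseteq> convex_cone hull (set_vec ` S)"
    by (intro hull_minimal convex_cone_convex_cone_hull)
  then show ?thesis using mem_cone_level_sets by blast
qed

lemma order_cone_chain:
  assumes "chain_subset S"
  shows "order_cone S = convex_cone hull (set_vec ` S)"
proof
  show "order_cone S \<subseteq> convex_cone hull (set_vec ` S)"
    using cone_of_level_sets level_set_order_cone[OF assms] by blast
  show "convex_cone hull (set_vec ` S) \<subseteq> order_cone S"
    by (intro hull_minimal convex_cone_order_cone) (auto simp: order_cone_def)
qed

text \<open>The level sets of a point depend on the point alone. If it lies in both cones they
  belong to both chains, although the union of the chains need not be a chain.\<close>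

lemma order_cone_Int:
  assumes "chain_subset S" "chain_subset T"
  shows "order_cone S \<inter> order_cone T = order_cone (S \<inter> T)"
proof
  show "order_cone S \<inter> order_cone T \<subseteq> order_cone (S \<inter> T)"
  proof
    fix x assume x: "x \<in> order_cone S \<inter> order_cone T"
    have "range (level_set x) \<subseteq> insert UNIV (S \<inter> T)"
      using level_set_order_cone[OF assms(1)] level_set_order_cone[OF assms(2)] x by blast
    then have "x \<in> convex_cone hull (set_vec ` (S \<inter> T))" by (rule cone_of_level_sets)
    then show "x \<in> order_cone (S \<inter> T)"
      using order_cone_chain[OF chain_subset_mono[OF assms(1) Int_lower1]] by simp
  qed
qed (use order_cone_mono[of "S \<inter> T"] in simp)

text \<open>In a chain any two coordinates are comparable. If an inequality defining the smaller
  cone fails at \<open>a\<close>, it cannot be one of the larger cone, so the opposite inequality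
  is; at \<open>b\<close> this prevents the excess at \<open>a\<close> from being
  compensated.\<close>

lemma order_cone_face:
  assumes S: "chain_subset S" and T: "T \<subseteq> S"
  shows "order_cone T face_of order_cone S"
proof -
  have half: "a \<in> order_cone T"
    if a: "a \<in> order_cone S" and b: "b \<in> order_cone S" and u: "0 < u" "u < 1"
      and x: "(1 - u) *\<^sub>R a + u *\<^sub>R b \<in> order_cone T" for a b u
    unfolding order_cone_def
  proof (intro CollectI allI impI, rule ccontr)
    fix i j assume ij: "\<forall>F\<in>T. i \<in> F \<longrightarrow> j \<in> F" and neg: "\<not> coord_diff i j a \<le> 0"
    have flip: "coord_diff j i y = - coord_diff i j y" for y by transfer simp
    have "\<not> (\<forall>F\<in>S. i \<in> F \<longrightarrow> j \<in> F)" using a neg unfolding order_cone_def by blast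
    then have "\<forall>F\<in>S. j \<in> F \<longrightarrow> i \<in> F" using S unfolding chain_subset_def by blast
    then have "coord_diff j i b \<le> 0" using b unfolding order_cone_def by blast
    then have "coord_diff i j b \<ge> 0" using flip[of b] by linarith
    then have "(1 - u) * coord_diff i j a + u * coord_diff i j b > 0"
      using neg u by (intro add_pos_nonneg mult_pos_pos) auto
    moreover have "coord_diff i j ((1 - u) *\<^sub>R a + u *\<^sub>R b) \<le> 0"
      using x ij unfolding order_cone_def by blast
    ultimately show False by simp
  qed
  have "a \<in> order_cone T \<and> b \<in> order_cone T"
    if ab: "a \<in> order_cone S" "b \<in> order_cone S" "x \<in> order_cone T" "x \<in> open_segment a b" for a b x
  proof -
    obtain u where u: "0 < u" "u < 1" "x = (1 - u) *\<^sub>R a + u *\<^sub>R b"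
      using ab(4) unfolding in_segment by blast
    then have "(1 - (1 - u)) *\<^sub>R b + (1 - u) *\<^sub>R a \<in> order_cone T"
      using ab(3) by (simp add: add.commute)
    then show ?thesis using half[of a b u] half[of b a "1 - u"] u ab by auto
  qed
  then show ?thesis
    unfolding face_of_def
    using order_cone_mono[OF T] convex_cone_order_cone[of T] unfolding convex_cone_def by blast
qed

text \<open>The level set of \<open>set_vec F\<close> at an element of \<open>F\<close> is
  \<open>F\<close> itself. Hence a cone over a chain remembers the chain.\<close>

lemma set_vec_mem_order_cone:
  assumes S: "chain_subset S" and F: "set_vec F \<in> order_cone S" "F \<noteq> {}" "F \<noteq> UNIV"
  shows "F \<in> S"
proof -
  obtain k where k: "k \<in> F" using F(2) by blast
  have "level_set (set_vec F) k = F" using k unfolding level_set_def by auto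
  then show ?thesis using level_set_order_cone[OF S F(1), of k] F(3) by simp
qed

text \<open>For a member \<open>F\<close> of a chain, the functional takes a coordinate in \<open>F\<close> but not in the
  predecessor of \<open>F\<close>, minus a coordinate in the successor of \<open>F\<close> but not in \<open>F\<close>.\<close>

lemma dual_coord_diff:
  assumes S: "chain_subset S" "F \<in> S" and ne: "{} \<notin> S" "UNIV \<notin> S"
  obtains i j :: "'e::finite" where
    "\<And>G. G \<in> S \<Longrightarrow> coord_diff i j (set_vec G) = (if G = F then 1 else 0)"
proof -
  let ?L = "{G \<in> S. G \<subset> F}" and ?U = "{G \<in> S. F \<subset> G}"
  have "\<exists>i\<in>F. \<forall>G\<in>?L. i \<notin> G"
  proof (cases "?L = {}")
    case True
    moreover have "F \<noteq> {}" using S ne by blast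
    ultimately show ?thesis by blast
  next
    case False
    then have "\<Union>?L \<in> ?L" by (intro chain_subset_Union_mem chain_subset_mono[OF S(1)]) auto
    then have "\<Union>?L \<subset> F" by blast
    then show ?thesis by blast
  qed
  then obtain i where i: "i \<in> F" "\<And>G. G \<in> ?L \<Longrightarrow> i \<notin> G" by blast
  have "\<exists>j. j \<notin> F \<and> (\<forall>G\<in>?U. j \<in> G)"
  proof (cases "?U = {}")
    case True
    moreover have "F \<noteq> UNIV" using S ne by blast
    ultimately show ?thesis by blast
  next
    case False
    then have "\<Inter>?U \<in> ?U" by (intro chain_subset_Inter_mem chain_subset_mono[OF S(1)]) auto
    then obtain j where "j \<in> \<Inter>?U" "j \<notin> F" by blast
    then show ?thesis by (intro exI[of _ j]) auto
  qed
  then obtain j where j: "j \<notin> F" "\<And>G. G \<in> ?U \<Longrightarrow> j \<in> G" by blast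
  have "coord_diff i j (set_vec G) = (if G = F then 1 else 0)" if G: "G \<in> S" for G
  proof -
    consider "G = F" | "G \<subset> F" | "F \<subset> G" using S G unfolding chain_subset_def by blast
    then show ?thesis
    proof cases
      case 1
      then show ?thesis using i j by simp
    next
      case 2
      then have "i \<notin> G" "j \<notin> G" using i(2) j(1) G by blast+
      then show ?thesis using 2 by simp
    next
      case 3
      then have "i \<in> G" "j \<in> G" using i(1) j(2) G by blast+
      then show ?thesis using 3 by auto
    qed
  qed
  then show thesis by (rule that)
qed

lemma chain_unimodular:
  fixes S :: "'e::finite set set"
  assumes S: "chain_subset S" and ne: "{} \<notin> S" "UNIV \<notin> S"
  obtains \<phi> where "unimodular torus_lattice (set_vec ` S) \<phi>" "inj_on set_vec S"
proof -
  have "\<forall>F\<in>S. \<exists>i j. \<forall>G\<in>S. coord_diff i j (set_vec G) = (if G = F then 1 else 0)"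
    using dual_coord_diff[OF S _ ne] by metis
  then obtain p q where pq:
    "\<And>F G. \<lbrakk>F \<in> S; G \<in> S\<rbrakk> \<Longrightarrow> coord_diff (p F) (q F) (set_vec G) = (if G = F then 1 else 0)"
    by metis
  have inj: "inj_on set_vec S"
  proof (rule inj_onI)
    fix F G assume "F \<in> S" "G \<in> S" "set_vec F = set_vec G"
    then show "F = G" using pq[of F F] pq[of F G] by (auto split: if_splits)
  qed
  \<comment> \<open>The locale indexes functionals by vectors, while the coordinates
    \<open>p\<close> and \<open>q\<close> were chosen for sets.\<close>
  let ?\<phi> = "\<lambda>s. coord_diff (p (the_inv_into S set_vec s)) (q (the_inv_into S set_vec s))"
  have "unimodular torus_lattice (set_vec ` S) ?\<phi>"
  proof (rule unimodular.intro)
    show "finite (set_vec ` S)" by simp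
    show "set_vec ` S \<subseteq> torus_lattice" using set_vec_lattice by blast
    show "int_module.subspace torus_lattice" by (rule torus_lattice_subspace)
    show "linear (?\<phi> s)" for s by (rule linear_coord_diff)
    show "?\<phi> s x \<in> \<int>" if "x \<in> torus_lattice" for s x by (rule coord_diff_lattice[OF that])
    show "?\<phi> s t = (if s = t then 1 else 0)" if st: "s \<in> set_vec ` S" "t \<in> set_vec ` S" for s t
    proof -
      obtain F G where FG: "F \<in> S" "G \<in> S" "s = set_vec F" "t = set_vec G" using st by blast
      then have "set_vec F = set_vec G \<longleftrightarrow> G = F" using inj unfolding inj_on_def by blast
      then show ?thesis using FG pq[OF FG(1,2)] the_inv_into_f_f[OF inj FG(1)] by simp
    qed
  qed
  then show thesis using inj by (rule that)
qed


section \<open>Chains of flats\<close>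

lemma sorted_wrt_psubset_unique:
  "sorted_wrt (\<subset>) xs \<Longrightarrow> sorted_wrt (\<subset>) ys \<Longrightarrow> set xs = set ys \<Longrightarrow> xs = ys"
proof (induction xs arbitrary: ys)
  case (Cons x xs)
  then obtain y ys' where ys: "ys = y # ys'" by (cases ys) auto
  have x: "\<forall>z\<in>set xs. x \<subset> z" and y: "\<forall>z\<in>set ys'. y \<subset> z"
    using Cons.prems ys by simp_all
  have xy: "x = y"
  proof (rule ccontr)
    assume "x \<noteq> y"
    then have "x \<in> set ys'" "y \<in> set xs" using Cons.prems(3) ys by auto
    then have "y \<subset> x" "x \<subset> y" using x y by simp_all
    then show False by simp
  qed
  have "x \<notin> set xs" "x \<notin> set ys'" using x y xy by blast+
  then have "set xs = set ys'" using Cons.prems(3) ys xy by auto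
  then show ?case using Cons.IH[of ys'] Cons.prems(1,2) ys xy by simp
qed simp

text \<open>The product over consecutive pairs, in a form that splits at any entry of the list, as
  needed when a flat is inserted into a chain.\<close>

fun step_prod :: "('a \<Rightarrow> 'a \<Rightarrow> int) \<Rightarrow> 'a list \<Rightarrow> int" where
  "step_prod f (x # y # zs) = f x y * step_prod f (y # zs)"
| "step_prod f _ = 1"

lemma step_prod_append: "step_prod f (xs @ a # ys) = step_prod f (xs @ [a]) * step_prod f (a # ys)"
proof (induction xs)
  case (Cons x xs)
  then show ?case by (cases xs) simp_all
qed simp

text \<open>A chain of k flats has k + 2 entries with its two ends, and hence k + 1 steps.\<close>

lemma prod_nth_eq_step_prod:
  "length xs = k + 2 \<Longrightarrow> (\<Prod>i = 0..k. f (xs ! i) (xs ! (i + 1))) = step_prod f xs"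
proof (induction k arbitrary: xs)
  case 0
  then obtain x y where "xs = [x, y]" by (auto simp: length_Suc_conv numeral_2_eq_2)
  then show ?case by simp
next
  case (Suc k)
  then obtain x y zs where xs: "xs = x # y # zs" by (auto simp: length_Suc_conv)
  then have "(\<Prod>i = 0..k. f ((y # zs) ! i) ((y # zs) ! (i + 1))) = step_prod f (y # zs)"
    using Suc.IH[of "y # zs"] Suc.prems by simp
  then show ?case unfolding xs by (simp add: prod.atLeast0_atMost_Suc_shift del: prod.cl_ivl_Suc)
qed

text \<open>The torus has a coordinate for every element of the type, so the ground set must be the
  whole type.\<close>

locale full_matroid = matroid M for M :: "'e::finite set_system" +
  assumes ground_UNIV: "ground M = UNIV"
begin

lemma chain_ext_eq: "chain_ext M Fs = {} # Fs @ [UNIV]"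
  unfolding chain_ext_def ground_UNIV by simp

lemma flat_chain_iff:
  "flat_chain M Fs \<longleftrightarrow> set Fs \<subseteq> flats M \<and> sorted_wrt (\<subset>) Fs \<and> {} \<notin> set Fs \<and> UNIV \<notin> set Fs"
proof -
  have "({} :: 'e set) \<subset> UNIV" by auto
  moreover have "(\<forall>F\<in>set Fs. {} \<subset> F) \<longleftrightarrow> {} \<notin> set Fs" by auto
  moreover have "(\<forall>F\<in>set Fs. F \<subset> UNIV) \<longleftrightarrow> UNIV \<notin> set Fs" by auto
  ultimately show ?thesis unfolding flat_chain_def chain_ext_eq by (auto simp: sorted_wrt_append)
qed

lemma flat_chain_chain_subset: "flat_chain M Fs \<Longrightarrow> chain_subset (set Fs)"
proof -
  have "chain_subset (set Fs)" if "sorted_wrt (\<subset>) Fs"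
    using that by (induction Fs) (auto simp: chain_subset_def)
  then show "flat_chain M Fs \<Longrightarrow> chain_subset (set Fs)" unfolding flat_chain_iff by blast
qed

lemma flat_chain_card: "flat_chain M Fs \<Longrightarrow> card (set Fs) = length Fs"
proof -
  have "distinct Fs" if "sorted_wrt (\<subset>) Fs"
    using that by (induction Fs) auto
  then show "flat_chain M Fs \<Longrightarrow> card (set Fs) = length Fs"
    unfolding flat_chain_iff using distinct_card by blast
qed

lemma flat_chain_filter: "flat_chain M Fs \<Longrightarrow> flat_chain M (filter P Fs)"
  unfolding flat_chain_iff by (auto intro: sorted_wrt_filter)

lemma flat_chain_unimodular:
  assumes "flat_chain M Fs"
  obtains \<phi> where "unimodular torus_lattice (set_vec ` set Fs) \<phi>" "inj_on set_vec (set Fs)"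
  using chain_unimodular[OF flat_chain_chain_subset[OF assms]] assms
  unfolding flat_chain_iff by blast

lemma dim_chain_cone:
  assumes "flat_chain M Fs"
  shows "dim (chain_cone Fs) = length Fs"
proof -
  obtain \<phi> where \<phi>: "unimodular torus_lattice (set_vec ` set Fs) \<phi>" and inj: "inj_on set_vec (set Fs)"
    using flat_chain_unimodular[OF assms] by blast
  show ?thesis
    unfolding chain_cone_eq unimodular.dim_cone[OF \<phi>] card_image[OF inj] flat_chain_card[OF assms] ..
qed

lemma chain_cone_order_cone: "flat_chain M Fs \<Longrightarrow> chain_cone Fs = order_cone (set Fs)"
  unfolding chain_cone_eq using order_cone_chain[OF flat_chain_chain_subset] by blast

lemma chain_cone_subset_iff:
  assumes "flat_chain M Fs" "flat_chain M Gs"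
  shows "chain_cone Fs \<subseteq> chain_cone Gs \<longleftrightarrow> set Fs \<subseteq> set Gs"
proof
  assume sub: "chain_cone Fs \<subseteq> chain_cone Gs"
  show "set Fs \<subseteq> set Gs"
  proof
    fix F assume F: "F \<in> set Fs"
    then have "set_vec F \<in> chain_cone Gs"
      using sub hull_inc[of "set_vec F" "set_vec ` set Fs" convex_cone] unfolding chain_cone_eq by blast
    moreover have "F \<noteq> {}" "F \<noteq> UNIV" using F assms(1) unfolding flat_chain_iff by auto
    ultimately show "F \<in> set Gs"
      using set_vec_mem_order_cone[OF flat_chain_chain_subset[OF assms(2)]]
        chain_cone_order_cone[OF assms(2)] by simp
  qed
next
  assume "set Fs \<subseteq> set Gs"
  then show "chain_cone Fs \<subseteq> chain_cone Gs"
    unfolding chain_cone_eq by (intro hull_mono image_mono)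
qed

lemma chain_cone_inj:
  assumes "flat_chain M Fs" "flat_chain M Gs" "chain_cone Fs = chain_cone Gs"
  shows "Fs = Gs"
proof -
  have "set Fs = set Gs"
    using chain_cone_subset_iff[OF assms(1,2)] chain_cone_subset_iff[OF assms(2,1)] assms(3) by auto
  then show ?thesis
    using sorted_wrt_psubset_unique assms(1,2) unfolding flat_chain_iff by blast
qed

lemma flat_chain_insert:
  assumes Fs: "flat_chain M Fs" and F: "F \<in> flats M" and i: "i \<le> length Fs"
    and lo: "chain_ext M Fs ! i \<subset> F" and up: "F \<subset> chain_ext M Fs ! Suc i"
  obtains Gs where "flat_chain M Gs" "set Gs = insert F (set Fs)" "F \<notin> set Fs"
    "chain_ext M Gs = take (Suc i) (chain_ext M Fs) @ F # drop (Suc i) (chain_ext M Fs)"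
proof -
  let ?E = "chain_ext M Fs"
  \<comment> \<open>Gap \<open>i\<close> lies between the entries \<open>i\<close> and
    \<open>Suc i\<close> of the extended chain. The leading empty set shifts the index by one, so
    the new flat goes after the first \<open>i\<close> members of \<open>Fs\<close>.\<close>
  let ?Gs = "take i Fs @ F # drop i Fs"
  have ext: "chain_ext M ?Gs = take (Suc i) ?E @ F # drop (Suc i) ?E"
    using i unfolding chain_ext_eq by simp
  have sorted: "sorted_wrt (\<subset>) ?E" using Fs unfolding flat_chain_def by blast
  have len: "length ?E = length Fs + 2" unfolding chain_ext_eq by simp
  have below: "x \<subset> F" if x: "x \<in> set (take (Suc i) ?E)" for x
  proof -
    obtain j where "j \<le> i" "x = ?E ! j"
      using x i len by (auto simp: in_set_conv_nth less_Suc_eq_le)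
    then have "x \<subseteq> ?E ! i"
      using sorted_wrt_nth_less[OF sorted, of j i] i len by (cases "j = i") auto
    then show ?thesis using lo by blast
  qed
  have above: "F \<subset> x" if x: "x \<in> set (drop (Suc i) ?E)" for x
  proof -
    obtain j where j: "j < length ?E - Suc i" "x = ?E ! (Suc i + j)"
      using x i len by (auto simp: in_set_conv_nth)
    then have "?E ! Suc i \<subseteq> x"
      using sorted_wrt_nth_less[OF sorted, of "Suc i" "Suc i + j"] i len
      by (cases "j = 0") (auto simp: less_diff_conv)
    then show ?thesis using up by blast
  qed
  have "sorted_wrt (\<subset>) (take (Suc i) ?E @ F # drop (Suc i) ?E)"
  proof -
    have "sorted_wrt (\<subset>) (take (Suc i) ?E @ drop (Suc i) ?E)" using sorted by simp
    then show ?thesis using below above unfolding sorted_wrt_append by auto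
  qed
  moreover have set: "set ?Gs = insert F (set Fs)"
    using set_append[of "take i Fs" "drop i Fs"] by simp
  ultimately have "flat_chain M ?Gs" using F Fs unfolding flat_chain_def ext by simp
  moreover have "F \<notin> set Fs"
  proof
    assume "F \<in> set Fs"
    then have "F \<in> set (take (Suc i) ?E) \<union> set (drop (Suc i) ?E)"
      unfolding set_append[symmetric] append_take_drop_id by (simp add: chain_ext_eq)
    then show False using below above by blast
  qed
  ultimately show thesis using set ext by (intro that)
qed

section \<open>Fan axioms and purity of the skeleton\<close>

lemma skeleton_bergman_fan:
  "skeleton k (bergman_fan M) = {chain_cone Fs | Fs. flat_chain M Fs \<and> length Fs \<le> k}"
  unfolding skeleton_def bergman_fan_def using dim_chain_cone by auto

lemma rational_fan_skeleton: "rational_fan torus_lattice (skeleton k (bergman_fan M))"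
  unfolding rational_fan_def
proof (intro conjI ballI allI impI)
  let ?\<Sigma> = "skeleton k (bergman_fan M)"
  have "?\<Sigma> \<subseteq> (\<lambda>S. convex_cone hull (set_vec ` S)) ` UNIV"
    unfolding skeleton_bergman_fan chain_cone_eq by blast
  then show "finite ?\<Sigma>" by (rule finite_subset) simp
  fix \<sigma> assume "\<sigma> \<in> ?\<Sigma>"
  then obtain Fs where Fs: "\<sigma> = chain_cone Fs" "flat_chain M Fs" "length Fs \<le> k"
    unfolding skeleton_bergman_fan by blast
  have "set_vec ` set Fs \<subseteq> torus_lattice" using set_vec_lattice by blast
  then show "rational_cone torus_lattice \<sigma>"
    unfolding rational_cone_def Fs(1) chain_cone_eq by blast
  show "\<tau> \<in> ?\<Sigma>" if \<tau>: "\<tau> face_of \<sigma> \<and> \<tau> \<noteq> {}" for \<tau>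
  proof -
    \<comment> \<open>A face is generated by the generators it contains, hence it is the cone over a
      subchain.\<close>
    let ?Gs = "filter (\<lambda>F. set_vec F \<in> \<tau>) Fs"
    have "\<tau> = convex_cone hull (set_vec ` set Fs \<inter> \<tau>)"
      using face_of_convex_cone_hull[of \<tau> "set_vec ` set Fs"] \<tau> unfolding Fs(1) chain_cone_eq by blast
    also have "set_vec ` set Fs \<inter> \<tau> = set_vec ` set ?Gs" by auto
    finally have "\<tau> = chain_cone ?Gs" unfolding chain_cone_eq .
    then show ?thesis
      unfolding skeleton_bergman_fan
      using flat_chain_filter[OF Fs(2)] le_trans[OF length_filter_le Fs(3)] by blast
  qed
  fix \<tau> assume "\<tau> \<in> ?\<Sigma>"
  then obtain Gs where Gs: "\<tau> = chain_cone Gs" "flat_chain M Gs"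
    unfolding skeleton_bergman_fan by blast
  note chains = flat_chain_chain_subset[OF Fs(2)] flat_chain_chain_subset[OF Gs(2)]
  have "\<sigma> \<inter> \<tau> = order_cone (set Fs \<inter> set Gs)"
    unfolding Fs(1) Gs(1) chain_cone_order_cone[OF Fs(2)] chain_cone_order_cone[OF Gs(2)]
    by (rule order_cone_Int[OF chains])
  then show "(\<sigma> \<inter> \<tau>) face_of \<sigma>" "(\<sigma> \<inter> \<tau>) face_of \<tau>"
    using order_cone_face[OF chains(1), of "set Fs \<inter> set Gs"]
      order_cone_face[OF chains(2), of "set Fs \<inter> set Gs"]
    unfolding Fs(1) Gs(1) chain_cone_order_cone[OF Fs(2)] chain_cone_order_cone[OF Gs(2)] by simp_all
qed

lemma chain_ext_flat:
  assumes "loopless M" "flat_chain M Fs" "i < length Fs + 2"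
  shows "chain_ext M Fs ! i \<in> flats M"
proof -
  have "chain_ext M Fs ! i \<in> set (chain_ext M Fs)"
    using assms(3) by (intro nth_mem) (simp add: chain_ext_eq)
  then show ?thesis
    using empty_flat[OF assms(1)] ground_flat assms(2) unfolding chain_ext_eq flat_chain_iff ground_UNIV
    by auto
qed

lemma chain_ext_psubset:
  assumes "flat_chain M Fs" "i < j" "j < length Fs + 2"
  shows "chain_ext M Fs ! i \<subset> chain_ext M Fs ! j"
  using assms sorted_wrt_nth_less[of "(\<subset>)" "chain_ext M Fs" i j]
  unfolding flat_chain_def by (simp add: chain_ext_eq)

text \<open>If every step raised the rank by at most one, the whole ground set would have rank at
  most \<open>length Fs + 1\<close>. So some gap has rank at least two and admits a flat
  inside.\<close>

lemma flat_chain_refine: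
  assumes "loopless M" and Fs: "flat_chain M Fs" and len: "length Fs + 1 < matroid_rank M"
  obtains Gs where "flat_chain M Gs" "set Fs \<subset> set Gs" "length Gs = length Fs + 1"
proof -
  let ?E = "chain_ext M Fs"
  have "\<exists>i\<le>length Fs. rk M (?E ! i) + 2 \<le> rk M (?E ! Suc i)"
  proof (rule ccontr)
    assume neg: "\<not> ?thesis"
    have "rk M (?E ! i) \<le> i" if "i \<le> length Fs + 1" for i
      using that
    proof (induction i)
      case 0
      then show ?case by (simp add: chain_ext_eq)
    next
      case (Suc i)
      then show ?case using neg by fastforce
    qed
    from this[of "length Fs + 1"] show False
      using len unfolding matroid_rank_def chain_ext_eq ground_UNIV by simp
  qed
  then obtain i where i: "i \<le> length Fs" "rk M (?E ! i) + 2 \<le> rk M (?E ! Suc i)" by blast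
  have "?E ! i \<subset> ?E ! Suc i" using i(1) by (intro chain_ext_psubset[OF Fs]) auto
  moreover have "?E ! i \<in> flats M" "?E ! Suc i \<in> flats M"
    using i(1) by (auto intro!: chain_ext_flat[OF assms(1) Fs])
  ultimately obtain F where F: "F \<in> flats M" "?E ! i \<subset> F" "F \<subset> ?E ! Suc i"
    using flat_between i(2) by (metis less_imp_le)
  obtain Gs where Gs: "flat_chain M Gs" "set Gs = insert F (set Fs)" "F \<notin> set Fs"
    "chain_ext M Gs = take (Suc i) ?E @ F # drop (Suc i) ?E"
    by (rule flat_chain_insert[OF Fs F(1) i(1) F(2,3)])
  have "length Gs = length Fs + 1"
    using flat_chain_card[OF Gs(1)] flat_chain_card[OF Fs] Gs(2,3) by simp
  then show thesis using Gs(1-3) by (intro that[of Gs]) auto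
qed

lemma pure_fan_skeleton:
  assumes "loopless M" "k < matroid_rank M"
  shows "pure_fan k (skeleton k (bergman_fan M))"
  unfolding pure_fan_def
proof (intro ballI impI)
  let ?\<Sigma> = "skeleton k (bergman_fan M)"
  fix \<sigma> assume \<sigma>: "\<sigma> \<in> ?\<Sigma>" and max: "\<forall>\<tau>\<in>?\<Sigma>. \<sigma> \<subseteq> \<tau> \<longrightarrow> \<tau> = \<sigma>"
  obtain Fs where Fs: "\<sigma> = chain_cone Fs" "flat_chain M Fs" "length Fs \<le> k"
    using \<sigma> unfolding skeleton_bergman_fan by blast
  have "length Fs = k"
  proof (rule ccontr)
    assume "length Fs \<noteq> k"
    then have lt: "length Fs + 1 \<le> k" using Fs(3) by simp
    then have "length Fs + 1 < matroid_rank M" using assms(2) by simp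
    then obtain Gs where Gs: "flat_chain M Gs" "set Fs \<subset> set Gs" "length Gs = length Fs + 1"
      using flat_chain_refine[OF assms(1) Fs(2)] by blast
    then have "chain_cone Gs \<in> ?\<Sigma>" using lt unfolding skeleton_bergman_fan by auto
    then have "chain_cone Gs = \<sigma>"
      using max chain_cone_subset_iff[OF Fs(2) Gs(1)] Gs(2) Fs(1) by blast
    then show False using chain_cone_inj[OF Gs(1) Fs(2)] Fs(1) Gs(2) by blast
  qed
  then show "dim \<sigma> = k" using dim_chain_cone[OF Fs(2)] Fs(1) by simp
qed

section \<open>Balancing\<close>

text \<open>Compare coordinates: on \<open>A\<close> every flat of the gap contributes, on
  \<open>B - A\<close> the value is the constant from \<open>beta_product_sum\<close>, and outside
  \<open>B\<close> there is nothing.\<close>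

lemma beta_weighted_sum:
  assumes A: "A \<in> flats M" and B: "B \<in> flats M" and AB: "A \<subseteq> B"
  shows "(\<Sum>F\<in>{F \<in> flats M. A \<subset> F \<and> F \<subset> B}.
      of_int (beta (minor M F A) * beta (minor M B F)) *\<^sub>R set_vec F) \<in> span {set_vec A, set_vec B}"
proof -
  let ?T = "{F \<in> flats M. A \<subset> F \<and> F \<subset> B}"
  let ?b = "\<lambda>F. beta (minor M F A) * beta (minor M B F)"
  obtain c where c: "\<And>e. e \<in> B - A \<Longrightarrow>
      (\<Sum>F\<in>{F \<in> flats M. A \<subset> F \<and> F \<subset> B \<and> e \<in> F}. ?b F) = c"
    using beta_product_sum[OF A B AB] by blast
  have fT: "finite ?T" by simp
  have coord: "(\<Sum>F\<in>?T. of_int (?b F) *\<^sub>R ind_vec F) =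
      of_int (sum ?b ?T) *\<^sub>R ind_vec A + of_int c *\<^sub>R (ind_vec B - ind_vec A)"
  proof (subst vec_eq_iff, rule allI)
    fix e
    have "(\<Sum>F\<in>?T. of_int (?b F) *\<^sub>R ind_vec F) $ e = (\<Sum>F\<in>?T. if e \<in> F then of_int (?b F) else 0)"
      unfolding sum_component by (rule sum.cong[OF refl]) simp
    also have "\<dots> = of_int (\<Sum>F\<in>{F \<in> ?T. e \<in> F}. ?b F)"
      by (simp only: sum.inter_filter[OF fT, symmetric] of_int_sum)
    finally have lhs: "(\<Sum>F\<in>?T. of_int (?b F) *\<^sub>R ind_vec F) $ e = of_int (\<Sum>F\<in>{F \<in> ?T. e \<in> F}. ?b F)" .
    consider "e \<in> A" | "e \<in> B - A" | "e \<notin> B" by blast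
    then show "(\<Sum>F\<in>?T. of_int (?b F) *\<^sub>R ind_vec F) $ e =
        (of_int (sum ?b ?T) *\<^sub>R ind_vec A + of_int c *\<^sub>R (ind_vec B - ind_vec A)) $ e"
    proof cases
      case 1
      then have "{F \<in> ?T. e \<in> F} = ?T" "e \<in> B" using AB by auto
      then show ?thesis unfolding lhs using 1 by simp
    next
      case 2
      have "{F \<in> ?T. e \<in> F} = {F \<in> flats M. A \<subset> F \<and> F \<subset> B \<and> e \<in> F}" by auto
      then have "(\<Sum>F\<in>{F \<in> ?T. e \<in> F}. ?b F) = c" using c[OF 2] by simp
      then show ?thesis unfolding lhs using 2 by simp
    next
      case 3
      then have "{F \<in> ?T. e \<in> F} = {}" "e \<notin> A" using AB by auto
      then show ?thesis unfolding lhs using 3 by (simp only:) simp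
    qed
  qed
  have "(\<Sum>F\<in>?T. of_int (?b F) *\<^sub>R set_vec F) = torus_proj (\<Sum>F\<in>?T. of_int (?b F) *\<^sub>R ind_vec F)"
    unfolding set_vec_def
    by (simp only: linear_sum[OF linear_torus_proj] linear_scale[OF linear_torus_proj])
  also have "\<dots> = of_int (sum ?b ?T) *\<^sub>R set_vec A + of_int c *\<^sub>R (set_vec B - set_vec A)"
    unfolding coord set_vec_def
    by (simp only: linear_add[OF linear_torus_proj] linear_scale[OF linear_torus_proj]
        linear_diff[OF linear_torus_proj])
  also have "\<dots> \<in> span {set_vec A, set_vec B}"
    by (intro span_add span_scale span_diff span_base) auto
  finally show ?thesis .
qed

abbreviation gap_flats :: "'e set list \<Rightarrow> nat \<Rightarrow> 'e set set" where
  "gap_flats Fs i \<equiv> {F \<in> flats M. chain_ext M Fs ! i \<subset> F \<and> F \<subset> chain_ext M Fs ! Suc i}"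

lemma flat_chain_insert_gap:
  assumes "flat_chain M Fs" "i \<le> length Fs" "F \<in> gap_flats Fs i"
  obtains Gs where "flat_chain M Gs" "set Gs = insert F (set Fs)" "F \<notin> set Fs"
    "chain_ext M Gs = take (Suc i) (chain_ext M Fs) @ F # drop (Suc i) (chain_ext M Fs)"
  using assms flat_chain_insert[of Fs F i thesis] by simp

text \<open>Inserting a flat replaces one step of the chain by two. The constant collects the global
  sign and the beta invariants of all other steps.\<close>

lemma csm_weight:
  assumes Fs: "flat_chain M Fs" and i: "i \<le> length Fs" and k: "k = length Fs + 1"
  obtains c where "\<And>F. F \<in> gap_flats Fs i \<Longrightarrow>
    snd (csm k M) (convex_cone hull (set_vec ` insert F (set Fs))) =
      c * (beta (minor M F (chain_ext M Fs ! i)) * beta (minor M (chain_ext M Fs ! Suc i) F))"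
proof -
  let ?E = "chain_ext M Fs"
  let ?f = "\<lambda>A B. beta (minor M B A)"
  let ?c = "(- 1) ^ (matroid_rank M - 1 - k) *
    (step_prod ?f (take (Suc i) ?E) * step_prod ?f (drop (Suc i) ?E))"
  have len: "length ?E = length Fs + 2" by (simp add: chain_ext_eq)
  have "snd (csm k M) (convex_cone hull (set_vec ` insert F (set Fs))) =
      ?c * (?f (?E ! i) F * ?f F (?E ! Suc i))" if F: "F \<in> gap_flats Fs i" for F
  proof -
    obtain Gs where Gs: "flat_chain M Gs" "set Gs = insert F (set Fs)" "F \<notin> set Fs"
      "chain_ext M Gs = take (Suc i) ?E @ F # drop (Suc i) ?E"
      by (rule flat_chain_insert_gap[OF Fs i F])
    have cone: "convex_cone hull (set_vec ` insert F (set Fs)) = chain_cone Gs"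
      unfolding chain_cone_eq Gs(2) ..
    have "(THE Hs. flat_chain M Hs \<and> chain_cone Hs = chain_cone Gs) = Gs"
      using Gs(1) chain_cone_inj by (intro the_equality) auto
    then have w: "snd (csm k M) (convex_cone hull (set_vec ` insert F (set Fs))) = chain_weight M k Gs"
      unfolding cone csm_def by simp
    have take: "take (Suc i) ?E = take i ?E @ [?E ! i]" and drop: "drop (Suc i) ?E = ?E ! Suc i # drop (Suc (Suc i)) ?E"
      using i len by (auto simp: take_Suc_conv_app_nth Cons_nth_drop_Suc)
    have "length (chain_ext M Gs) = k + 2" unfolding Gs(4) using len k i by simp
    then have "chain_weight M k Gs = (- 1) ^ (matroid_rank M - 1 - k) * step_prod ?f (chain_ext M Gs)"
      unfolding chain_weight_def by (simp only: prod_nth_eq_step_prod[of "chain_ext M Gs" k ?f])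
    also have "step_prod ?f (chain_ext M Gs) =
        step_prod ?f (take i ?E @ [?E ! i]) * (?f (?E ! i) F * (?f F (?E ! Suc i) * step_prod ?f (drop (Suc i) ?E)))"
      unfolding Gs(4) take append.assoc append.simps
        step_prod_append[of ?f "take i ?E" "?E ! i" "F # drop (Suc i) ?E"]
      by (simp add: drop)
    finally show ?thesis unfolding w take by (simp only: mult_ac)
  qed
  then show thesis by (rule that)
qed

lemma gap_flat_cone:
  assumes Fs: "flat_chain M Fs" and i: "i \<le> length Fs" and F: "F \<in> gap_flats Fs i"
  shows "set_vec F \<in> lattice_normals torus_lattice (chain_cone Fs) (convex_cone hull (set_vec ` insert F (set Fs)))"
    and "v \<in> lattice_normals torus_lattice (chain_cone Fs) (convex_cone hull (set_vec ` insert F (set Fs))) \<Longrightarrow>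
      v - set_vec F \<in> span (chain_cone Fs)"
proof -
  obtain Gs where Gs: "flat_chain M Gs" "set Gs = insert F (set Fs)" "F \<notin> set Fs"
    "chain_ext M Gs = take (Suc i) (chain_ext M Fs) @ F # drop (Suc i) (chain_ext M Fs)"
    by (rule flat_chain_insert_gap[OF Fs i F])
  obtain \<phi> where \<phi>: "unimodular torus_lattice (set_vec ` insert F (set Fs)) \<phi>"
    and inj: "inj_on set_vec (insert F (set Fs))"
    using flat_chain_unimodular[OF Gs(1)] unfolding Gs(2) by blast
  have rem: "set_vec ` insert F (set Fs) - {set_vec F} = set_vec ` set Fs"
    using inj Gs(3) unfolding inj_on_def by blast
  show "set_vec F \<in> lattice_normals torus_lattice (chain_cone Fs) (convex_cone hull (set_vec ` insert F (set Fs)))"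
    using unimodular.generator_lattice_normal[OF \<phi>, of "set_vec F"] unfolding rem chain_cone_eq by blast
  assume "v \<in> lattice_normals torus_lattice (chain_cone Fs) (convex_cone hull (set_vec ` insert F (set Fs)))"
  then show "v - set_vec F \<in> span (chain_cone Fs)"
    using unimodular.lattice_normal_unique[OF \<phi>, of "set_vec F" v]
    unfolding rem chain_cone_eq span_convex_cone_hull by blast
qed

text \<open>A chain with one more flat determines that flat, and the flat determines its gap. This
  splits the balancing sum into one sum per gap.\<close>

lemma star_bij_betw:
  assumes Fs: "flat_chain M Fs" and k: "k = length Fs + 1"
  shows "bij_betw (\<lambda>(i, F). convex_cone hull (set_vec ` insert F (set Fs)))
    (SIGMA i:{..<k}. gap_flats Fs i)
    {\<sigma> \<in> skeleton k (bergman_fan M). dim \<sigma> = k \<and> chain_cone Fs \<subset> \<sigma>}"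
    (is "bij_betw ?\<kappa> ?I ?S")
proof (rule bij_betw_imageI)
  have ins: "\<exists>Gs. flat_chain M Gs \<and> set Gs = insert F (set Fs) \<and> F \<notin> set Fs \<and>
      convex_cone hull (set_vec ` insert F (set Fs)) = chain_cone Gs"
    if iF: "i < k" "F \<in> gap_flats Fs i" for i F
  proof -
    have i: "i \<le> length Fs" using iF(1) k by simp
    obtain Gs where "flat_chain M Gs" "set Gs = insert F (set Fs)" "F \<notin> set Fs"
      "chain_ext M Gs = take (Suc i) (chain_ext M Fs) @ F # drop (Suc i) (chain_ext M Fs)"
      by (rule flat_chain_insert_gap[OF Fs i iF(2)])
    then show ?thesis unfolding chain_cone_eq by (intro exI[of _ Gs]) simp
  qed
  show "inj_on ?\<kappa> ?I"
  proof (rule inj_onI)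
    fix x y assume x: "x \<in> ?I" and y: "y \<in> ?I" and xy: "?\<kappa> x = ?\<kappa> y"
    obtain i F where iF: "x = (i, F)" "i < k" "F \<in> gap_flats Fs i" using x by auto
    obtain j G where jG: "y = (j, G)" "j < k" "G \<in> gap_flats Fs j" using y by auto
    have eq: "convex_cone hull (set_vec ` insert F (set Fs)) = convex_cone hull (set_vec ` insert G (set Fs))"
      using xy iF(1) jG(1) by simp
    obtain Hs where Hs: "flat_chain M Hs" "set Hs = insert F (set Fs)" "F \<notin> set Fs"
      "convex_cone hull (set_vec ` insert F (set Fs)) = chain_cone Hs"
      using ins[OF iF(2,3)] by blast
    obtain Ks where Ks: "flat_chain M Ks" "set Ks = insert G (set Fs)" "G \<notin> set Fs"
      "convex_cone hull (set_vec ` insert G (set Fs)) = chain_cone Ks"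
      using ins[OF jG(2,3)] by blast
    have "Hs = Ks" using chain_cone_inj[OF Hs(1) Ks(1)] Hs(4) Ks(4) eq by simp
    then have FG: "F = G" using Hs(2,3) Ks(2,3) by blast
    \<comment> \<open>A flat inside gap \<open>a\<close> lies below entry \<open>Suc a\<close>,
      hence below every later entry \<open>b\<close>, so it cannot lie in a later gap.\<close>
    have order: "\<not> a < b" if "b < k" "F \<subset> chain_ext M Fs ! Suc a" "chain_ext M Fs ! b \<subset> F" for a b
    proof
      assume "a < b"
      then have "chain_ext M Fs ! Suc a \<subseteq> chain_ext M Fs ! b"
        using chain_ext_psubset[OF Fs, of "Suc a" b] that(1) k by (cases "Suc a = b") auto
      then show False using that by blast
    qed
    have "\<not> i < j" "\<not> j < i"
      using order[OF jG(2), of i] order[OF iF(2), of j] iF(3) jG(3) FG by blast+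
    then show "x = y" using FG iF(1) jG(1) by simp
  qed
  show "?\<kappa> ` ?I = ?S"
  proof (intro equalityI subsetI)
    fix \<sigma> assume "\<sigma> \<in> ?\<kappa> ` ?I"
    then obtain i F where iF: "i < k" "F \<in> gap_flats Fs i" "\<sigma> = convex_cone hull (set_vec ` insert F (set Fs))"
      by auto
    obtain Gs where Gs: "flat_chain M Gs" "set Gs = insert F (set Fs)" "F \<notin> set Fs" "\<sigma> = chain_cone Gs"
      using ins[OF iF(1,2)] iF(3) by blast
    have len: "length Gs = k"
      using flat_chain_card[OF Gs(1)] flat_chain_card[OF Fs] Gs(2,3) k by simp
    have "chain_cone Fs \<subseteq> \<sigma>" "\<not> \<sigma> \<subseteq> chain_cone Fs"
      using chain_cone_subset_iff[OF Fs Gs(1)] chain_cone_subset_iff[OF Gs(1) Fs] Gs by auto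
    then show "\<sigma> \<in> ?S"
      unfolding skeleton_bergman_fan using Gs(1,4) len dim_chain_cone[OF Gs(1)] by auto
  next
    fix \<sigma> assume "\<sigma> \<in> ?S"
    then obtain Gs where Gs: "\<sigma> = chain_cone Gs" "flat_chain M Gs" "dim \<sigma> = k" "chain_cone Fs \<subset> \<sigma>"
      unfolding skeleton_bergman_fan by blast
    have len: "length Gs = k" using Gs(1-3) dim_chain_cone by simp
    have sub: "set Fs \<subseteq> set Gs" using chain_cone_subset_iff[OF Fs Gs(2)] Gs(1,4) by blast
    have "card (set Gs - set Fs) = 1"
      using card_Diff_subset[OF _ sub] flat_chain_card[OF Gs(2)] flat_chain_card[OF Fs] len k by simp
    then obtain F where F: "set Gs - set Fs = {F}" by (rule card_1_singletonE)
    then have FG: "F \<in> set Gs" "F \<notin> set Fs" by auto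
    have setG: "set Gs = insert F (set Fs)" using F sub by auto
    obtain us vs where uv: "Gs = us @ F # vs" using FG(1) by (auto dest: split_list)
    have sorted: "sorted_wrt (\<subset>) (us @ F # vs)" using Gs(2) uv unfolding flat_chain_iff by simp
    then have uF: "\<And>x. x \<in> set us \<Longrightarrow> x \<subset> F" and Fv: "\<And>x. x \<in> set vs \<Longrightarrow> F \<subset> x"
      and suv: "sorted_wrt (\<subset>) (us @ vs)"
      unfolding sorted_wrt_append by auto
    have "F \<notin> set us" "F \<notin> set vs" using uF Fv by blast+
    then have "set (us @ vs) = set Fs" using setG uv FG(2) by auto
    then have Fs_eq: "Fs = us @ vs"
      using sorted_wrt_psubset_unique[OF suv, of Fs] Fs unfolding flat_chain_iff by simp
    \<comment> \<open>The empty set precedes \<open>us\<close> in the extended chain, so entry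
      \<open>length us\<close> is the last one before \<open>F\<close>.\<close>
    let ?i = "length us"
    have F': "F \<in> flats M" "{} \<subset> F" "F \<subset> UNIV"
      using FG(1) Gs(2) unfolding flat_chain_iff by auto
    have ext: "chain_ext M Fs = ({} # us) @ (vs @ [UNIV])" unfolding chain_ext_eq Fs_eq by simp
    have "chain_ext M Fs ! ?i = ({} # us) ! ?i" unfolding ext by (subst nth_append) simp
    also have "\<dots> \<in> set ({} # us)" by (intro nth_mem) simp
    finally have lo: "chain_ext M Fs ! ?i \<subset> F" using uF F'(2) by auto
    have "chain_ext M Fs ! Suc ?i = (vs @ [UNIV]) ! 0" unfolding ext by (subst nth_append) simp
    also have "\<dots> \<in> set (vs @ [UNIV])" by (intro nth_mem) simp
    finally have up: "F \<subset> chain_ext M Fs ! Suc ?i" using Fv F'(3) by auto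
    have "?i < k" unfolding k Fs_eq by simp
    then have "(?i, F) \<in> ?I" using lo up F'(1) by simp
    moreover have "\<sigma> = ?\<kappa> (?i, F)" using Gs(1) setG unfolding chain_cone_eq by simp
    ultimately show "\<sigma> \<in> ?\<kappa> ` ?I" by blast
  qed
qed

text \<open>Inner entries are generators of the cone; the two ends give the zero vector.\<close>

lemma set_vec_chain_ext_span:
  assumes "i < length Fs + 2"
  shows "set_vec (chain_ext M Fs ! i) \<in> span (chain_cone Fs)"
proof -
  have "chain_ext M Fs ! i \<in> set (chain_ext M Fs)"
    using assms by (intro nth_mem) (simp add: chain_ext_eq)
  then show ?thesis
    unfolding chain_cone_eq span_convex_cone_hull by (auto simp: chain_ext_eq span_zero intro: span_base)
qed

lemma balanced_at_chain_cone:
  assumes ll: "loopless M" and Fs: "flat_chain M Fs" and k: "k = length Fs + 1"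
  shows "balanced_at torus_lattice k (csm k M) (chain_cone Fs)"
proof -
  let ?\<tau> = "chain_cone Fs"
  let ?S = "{\<sigma> \<in> skeleton k (bergman_fan M). dim \<sigma> = k \<and> ?\<tau> \<subset> \<sigma>}"
  let ?\<kappa> = "\<lambda>F. convex_cone hull (set_vec ` insert F (set Fs))"
  let ?w = "snd (csm k M)"
  let ?N = "lattice_normals torus_lattice ?\<tau>"
  note bij = star_bij_betw[OF Fs k]
  have mem: "?\<kappa> F \<in> ?S" if "i < k" "F \<in> gap_flats Fs i" for i F
    using bij_betw_apply[OF bij, of "(i, F)"] that by auto
  have nonempty: "?N \<sigma> \<noteq> {}" if "\<sigma> \<in> ?S" for \<sigma>
  proof -
    have "\<sigma> \<in> (\<lambda>(i, F). ?\<kappa> F) ` (SIGMA i:{..<k}. gap_flats Fs i)"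
      using bij_betw_imp_surj_on[OF bij] that by simp
    then obtain i F where "i < k" "F \<in> gap_flats Fs i" "\<sigma> = ?\<kappa> F" by auto
    then show ?thesis using gap_flat_cone(1)[OF Fs, of i F] k by auto
  qed
  have balance: "(\<Sum>\<sigma>\<in>?S. of_int (?w \<sigma>) *\<^sub>R v \<sigma>) \<in> span ?\<tau>" if v: "\<forall>\<sigma>\<in>?S. v \<sigma> \<in> ?N \<sigma>" for v
  proof -
    have "(\<Sum>\<sigma>\<in>?S. of_int (?w \<sigma>) *\<^sub>R v \<sigma>) =
        (\<Sum>i<k. \<Sum>F\<in>gap_flats Fs i. of_int (?w (?\<kappa> F)) *\<^sub>R v (?\<kappa> F))"
      unfolding sum.reindex_bij_betw[OF bij, symmetric]
      by (subst sum.Sigma) (auto intro!: sum.cong)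
    also have "\<dots> \<in> span ?\<tau>"
    proof (rule span_sum)
      fix i assume "i \<in> {..<k}"
      then have i: "i < k" "i \<le> length Fs" using k by auto
      let ?A = "chain_ext M Fs ! i" and ?B = "chain_ext M Fs ! Suc i"
      let ?b = "\<lambda>F. beta (minor M F ?A) * beta (minor M ?B F)"
      obtain c where c: "\<And>F. F \<in> gap_flats Fs i \<Longrightarrow> ?w (?\<kappa> F) = c * ?b F"
        using csm_weight[OF Fs i(2) k] by blast
      \<comment> \<open>Replacing each chosen normal by \<open>set_vec F\<close> costs an element of
        the span; what remains is the sum handled by \<open>beta_weighted_sum\<close>.\<close>
      have "(\<Sum>F\<in>gap_flats Fs i. of_int (?w (?\<kappa> F)) *\<^sub>R v (?\<kappa> F)) =
          (\<Sum>F\<in>gap_flats Fs i. of_int (?w (?\<kappa> F)) *\<^sub>R (v (?\<kappa> F) - set_vec F)) +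
          of_int c *\<^sub>R (\<Sum>F\<in>gap_flats Fs i. of_int (?b F) *\<^sub>R set_vec F)"
        unfolding scaleR_right.sum sum.distrib[symmetric]
        using c by (intro sum.cong) (simp_all add: algebra_simps)
      moreover have "(\<Sum>F\<in>gap_flats Fs i. of_int (?w (?\<kappa> F)) *\<^sub>R (v (?\<kappa> F) - set_vec F)) \<in> span ?\<tau>"
      proof (intro span_sum span_scale)
        fix F assume F: "F \<in> gap_flats Fs i"
        have "v (?\<kappa> F) \<in> ?N (?\<kappa> F)" by (rule bspec[OF v mem[OF i(1) F]])
        then show "v (?\<kappa> F) - set_vec F \<in> span ?\<tau>" by (rule gap_flat_cone(2)[OF Fs i(2) F])
      qed
      moreover have "(\<Sum>F\<in>gap_flats Fs i. of_int (?b F) *\<^sub>R set_vec F) \<in> span ?\<tau>"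
      proof -
        have flats: "?A \<in> flats M" "?B \<in> flats M" "?A \<subseteq> ?B"
          using chain_ext_flat[OF ll Fs, of i] chain_ext_flat[OF ll Fs, of "Suc i"]
            chain_ext_psubset[OF Fs, of i "Suc i"] i(2) by auto
        have "{set_vec ?A, set_vec ?B} \<subseteq> span ?\<tau>"
          using set_vec_chain_ext_span[of i Fs] set_vec_chain_ext_span[of "Suc i" Fs] i(2) by simp
        then have "span {set_vec ?A, set_vec ?B} \<subseteq> span ?\<tau>" by (intro span_minimal) auto
        then show ?thesis using beta_weighted_sum[OF flats] by blast
      qed
      ultimately show "(\<Sum>F\<in>gap_flats Fs i. of_int (?w (?\<kappa> F)) *\<^sub>R v (?\<kappa> F)) \<in> span ?\<tau>"
        by (simp only: span_add span_scale)
    qed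
    finally show ?thesis .
  qed
  have pair: "csm k M = (skeleton k (bergman_fan M), ?w)" unfolding csm_def using ll by simp
  show ?thesis
    unfolding balanced_at_def by (subst pair) (use nonempty balance in \<open>simp add: Let_def\<close>)
qed

end

theorem theorem2p14:
  fixes M :: "'e::finite set_system" and d k :: nat
  assumes "matroid M" and "ground M = UNIV" and "matroid_rank M = d + 1" and "k \<le> d"
  shows "balanced_fan (torus_lattice :: 'e torus set) k (csm k M)"
proof -
  interpret full_matroid M
    using assms(1,2) by (simp add: full_matroid_def full_matroid_axioms_def)
  show ?thesis
  proof (cases "loopless M")
    case True
    have fst: "fst (csm k M) = skeleton k (bergman_fan M)" unfolding csm_def using True by simp
    have "balanced_at torus_lattice k (csm k M) \<tau>"
      if \<tau>: "\<tau> \<in> skeleton k (bergman_fan M)" "dim \<tau> + 1 = k" for \<tau>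
    proof -
      obtain Fs where "\<tau> = chain_cone Fs" "flat_chain M Fs"
        using \<tau>(1) unfolding skeleton_bergman_fan by blast
      then show ?thesis using balanced_at_chain_cone[OF True, of Fs k] dim_chain_cone[of Fs] \<tau>(2) by simp
    qed
    then show ?thesis
      unfolding balanced_fan_def fst
      using rational_fan_skeleton pure_fan_skeleton[OF True, of k] assms(3,4) by simp
  next
    \<comment> \<open>With a loop the fan is empty and every condition holds vacuously.\<close>
    case False
    then show ?thesis
      unfolding balanced_fan_def rational_fan_def pure_fan_def csm_def by simp
  qed
qed

end
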